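(* Let $X$ be a finite indecomposable quandle, $x_0\in X$, and $A$ an abelian group (written additively) with trivial $G_X$-action. Then the map $$H^2(X,A)\longrightarrow A\times \mathrm{Hom}(N_0,A),\qquad q\longmapsto \bigl(q_{x_0,x_0},\,(f_q)_0\bigr)$$ is an isomorphism of groups, so that $H^2(X,A)\simeq A\times\mathrm{Hom}(N_0,A)$.
   Context: A rack is a non-empty set $X$ with a binary operation $\triangleright$ such that every map $\varphi_x\colon y\mapsto x\triangleright y$ is bijective and $x\triangleright(y\triangleright z)=(x\triangleright y)\triangleright(x\triangleright z)$ for all $x,y,z$. A quandle is a rack with $x\triangleright x=x$ for all $x$. It is indecomposable if the group $\langle\varphi_x:x\in X\rangle\le \mathbb S_X$ acts transitively on $X$. The enveloping group is $G_X=\langle x\in X: xy=(x\triangleright y)x\rangle$; it acts on $X$ with the generator $x$ acting by $\varphi_x$, and the action is written $g\triangleright y$. Put $N_X=[G_X,G_X]$ and let $N_0$ be the stabilizer of $x_0$ in $N_X$. Rack cohomology $H^2(X,A)$ (trivial coefficients): a 2-cocycle is a map $q\colon X\times X\to A$, $(x,y)\mapsto q_{x,y}$, with $q_{x\triangleright y,x\triangleright z}+q_{x,z}=q_{x,y\triangleright z}+q_{y,z}$ for all $x,y,z$; two cocycles $q,q'$ are equivalent if there is $\gamma\colon X\to A$ with $q'_{x,y}=q_{x,y}+\gamma(x\triangleright y)-\gamma(y)$ for all $x,y$; $H^2(X,A)$ is the group of equivalence classes. Let $M=\mathrm{Fun}(X,A)$ be the right $G_X$-module of functions $X\to A$ with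 $(f\cdot g)(y)=f(g\triangleright y)$. A 1-cocycle $f\colon G_X\to M$ satisfies $f(uv)=f(u)\cdot v+f(v)$. For a 2-cocycle $q$, $f_q\colon G_X\to M$ denotes the 1-cocycle determined by $f_q(x)(y)=q_{x,y}$ for $x,y\in X$ (so $f_q(xy)(z)=q_{x,y\triangleright z}+q_{y,z}$ for $x,y,z\in X$). For a 1-cocycle $f$, $f_0\colon N_0\to A$ is $f_0(n_0)=f(n_0)(x_0)$. *)

theory Defs
  imports "HOL-Algebra.Bij" "HOL-Algebra.Generated_Groups"
begin

section \<open>Racks and quandles\<close>

locale rack =
  fixes X :: "'a set" and tr :: "'a \<Rightarrow> 'a \<Rightarrow> 'a"  (infixl "\<triangleright>" 70)
  assumes nonempty: "X \<noteq> {}"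
    and bij: "x \<in> X \<Longrightarrow> bij_betw (\<lambda>y. x \<triangleright> y) X X"
    and self_distrib: "\<lbrakk>x \<in> X; y \<in> X; z \<in> X\<rbrakk> \<Longrightarrow> x \<triangleright> (y \<triangleright> z) = (x \<triangleright> y) \<triangleright> (x \<triangleright> z)"

locale quandle = rack +
  assumes idem: "x \<in> X \<Longrightarrow> x \<triangleright> x = x"

definition inner_group :: "'a set \<Rightarrow> ('a \<Rightarrow> 'a \<Rightarrow> 'a) \<Rightarrow> ('a \<Rightarrow> 'a) set" where
  "inner_group X tr = generate (BijGroup X) ((\<lambda>x. \<lambda>y\<in>X. tr x y) ` X)"

definition indecomposable :: "'a set \<Rightarrow> ('a \<Rightarrow> 'a \<Rightarrow> 'a) \<Rightarrow> bool" where
  "indecomposable X tr \<longleftrightarrow> (\<forall>x\<in>X. \<forall>y\<in>X. \<exists>g\<in>inner_group X tr. g x = y)"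


section \<open>Groups given by generators and relations\<close>

text \<open>A letter (x, True) stands for the generator x, a letter (x, False) for its inverse;
  a relation (u, v) stands for u = v.\<close>

type_synonym 'a word = "('a \<times> bool) list"

abbreviation words :: "'a set \<Rightarrow> 'a word set" where
  "words S \<equiv> lists (S \<times> UNIV)"

inductive word_eq :: "'a set \<Rightarrow> ('a word \<times> 'a word) set \<Rightarrow> 'a word \<Rightarrow> 'a word \<Rightarrow> bool"
  for S R where
  refl: "w \<in> words S \<Longrightarrow> word_eq S R w w"
| sym: "word_eq S R u v \<Longrightarrow> word_eq S R v u"
| trans: "\<lbrakk>word_eq S R u v; word_eq S R v w\<rbrakk> \<Longrightarrow> word_eq S R u w"
| append: "\<lbrakk>word_eq S R u u'; word_eq S R v v'\<rbrakk> \<Longrightarrow> word_eq S R (u @ v) (u' @ v')"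
| cancel: "x \<in> S \<Longrightarrow> word_eq S R [(x, b), (x, \<not> b)] []"
| rel: "\<lbrakk>(u, v) \<in> R; u \<in> words S; v \<in> words S\<rbrakk> \<Longrightarrow> word_eq S R u v"

definition word_rel :: "'a set \<Rightarrow> ('a word \<times> 'a word) set \<Rightarrow> ('a word \<times> 'a word) set" where
  "word_rel S R = {(u, v). word_eq S R u v}"

definition presented_group :: "'a set \<Rightarrow> ('a word \<times> 'a word) set \<Rightarrow> 'a word set monoid" where
  "presented_group S R =
    \<lparr>carrier = words S // word_rel S R,
     mult = (\<lambda>g h. \<Union>u\<in>g. \<Union>v\<in>h. word_rel S R `` {u @ v}),
     one = word_rel S R `` {[]}\<rparr>"

definition word_inv :: "'a word \<Rightarrow> 'a word" where
  "word_inv w = rev (map (\<lambda>(x, b). (x, \<not> b)) w)"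

lemma word_eq_words: "word_eq S R u v \<Longrightarrow> u \<in> words S \<and> v \<in> words S"
  by (induction rule: word_eq.induct) auto

lemma equiv_word_rel: "equiv (words S) (word_rel S R)"
proof (rule equivI)
  show "word_rel S R \<subseteq> words S \<times> words S"
    using word_eq_words by (fastforce simp: word_rel_def)
  show "refl_on (words S) (word_rel S R)"
    by (auto simp: refl_on_def word_rel_def intro: word_eq.refl)
  show "sym (word_rel S R)"
    by (auto simp: sym_def word_rel_def intro: word_eq.sym)
  show "trans (word_rel S R)"
    unfolding trans_def word_rel_def by (auto intro: word_eq.trans)
qed

lemma presented_mult:
  assumes "u \<in> words S" "v \<in> words S"
  shows "word_rel S R `` {u} \<otimes>\<^bsub>presented_group S R\<^esub> word_rel S R `` {v} = word_rel S R `` {u @ v}"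
proof -
  have "(\<lambda>u v. word_rel S R `` {u @ v}) respects2 word_rel S R"
    unfolding congruent2_def
    by (auto intro!: equiv_class_eq[OF equiv_word_rel]) (simp add: word_rel_def word_eq.append)
  from UN_equiv_class2[OF equiv_word_rel equiv_word_rel this assms] show ?thesis
    by (simp add: presented_group_def)
qed

lemma word_inv_words: "w \<in> words S \<Longrightarrow> word_inv w \<in> words S"
  by (auto simp: word_inv_def)

lemma word_eq_inv: "w \<in> words S \<Longrightarrow> word_eq S R (word_inv w @ w) []"
proof (induction w)
  case Nil
  then show ?case by (auto simp: word_inv_def intro: word_eq.refl)
next
  case (Cons a w)
  obtain x b where a: "a = (x, b)" by (cases a)
  have x: "x \<in> S" and w: "w \<in> words S" using Cons.prems a by auto
  have "word_eq S R ([(x, \<not> b), (x, \<not> \<not> b)] @ w) ([] @ w)"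
    by (intro word_eq.append word_eq.cancel word_eq.refl x w)
  then have "word_eq S R (word_inv w @ ([(x, \<not> b), (x, b)] @ w)) (word_inv w @ w)"
    by (intro word_eq.append word_eq.refl word_inv_words w) simp
  moreover have "word_inv (a # w) @ a # w = word_inv w @ ([(x, \<not> b), (x, b)] @ w)"
    by (simp add: a word_inv_def)
  ultimately show ?case using Cons.IH[OF w] by (auto intro: word_eq.trans)
qed

lemma presented_carrierE:
  assumes "g \<in> carrier (presented_group S R)"
  obtains w where "w \<in> words S" "g = word_rel S R `` {w}"
  using assms by (auto simp: presented_group_def elim!: quotientE)

lemma group_presented_group: "group (presented_group S R)"
proof (rule groupI)
  have ex: "\<exists>w\<in>words S. g = word_rel S R `` {w}" if "g \<in> carrier (presented_group S R)" for g
    using that by (blast elim: presented_carrierE)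
  have carr: "carrier (presented_group S R) = words S // word_rel S R"
    and one: "\<one>\<^bsub>presented_group S R\<^esub> = word_rel S R `` {[]}"
    by (simp_all add: presented_group_def)
  show "\<one>\<^bsub>presented_group S R\<^esub> \<in> carrier (presented_group S R)"
    by (auto simp: carr one intro: quotientI)
  show "g \<otimes>\<^bsub>presented_group S R\<^esub> h \<in> carrier (presented_group S R)"
    if g: "g \<in> carrier (presented_group S R)" "h \<in> carrier (presented_group S R)" for g h
  proof -
    obtain u v where "u \<in> words S" "v \<in> words S" "g = word_rel S R `` {u}" "h = word_rel S R `` {v}"
      using g[THEN ex] by blast
    then show ?thesis by (auto simp: presented_mult carr intro!: quotientI)
  qed
  show "g \<otimes>\<^bsub>presented_group S R\<^esub> h \<otimes>\<^bsub>presented_group S R\<^esub> k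
      = g \<otimes>\<^bsub>presented_group S R\<^esub> (h \<otimes>\<^bsub>presented_group S R\<^esub> k)"
    if g: "g \<in> carrier (presented_group S R)" "h \<in> carrier (presented_group S R)"
      "k \<in> carrier (presented_group S R)" for g h k
  proof -
    obtain u v w where *: "u \<in> words S" "v \<in> words S" "w \<in> words S"
      "g = word_rel S R `` {u}" "h = word_rel S R `` {v}" "k = word_rel S R `` {w}"
      using g[THEN ex] by blast
    have "u @ v \<in> words S" "v @ w \<in> words S" using * by auto
    with * show ?thesis by (simp add: presented_mult)
  qed
  show "\<one>\<^bsub>presented_group S R\<^esub> \<otimes>\<^bsub>presented_group S R\<^esub> g = g"
    if g: "g \<in> carrier (presented_group S R)" for g
  proof -
    obtain u where *: "u \<in> words S" "g = word_rel S R `` {u}"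
      using g[THEN ex] by blast
    have "[] \<in> words S" by simp
    from presented_mult[OF this *(1), of R] show ?thesis by (simp add: one *(2))
  qed
  show "\<exists>h\<in>carrier (presented_group S R). h \<otimes>\<^bsub>presented_group S R\<^esub> g = \<one>\<^bsub>presented_group S R\<^esub>"
    if g: "g \<in> carrier (presented_group S R)" for g
  proof -
    obtain u where *: "u \<in> words S" "g = word_rel S R `` {u}"
      using g[THEN ex] by blast
    show ?thesis
    proof (rule bexI[of _ "word_rel S R `` {word_inv u}"])
      show "word_rel S R `` {word_inv u} \<in> carrier (presented_group S R)"
        using word_inv_words[OF *(1)] by (auto simp: carr intro: quotientI)
      have "(word_inv u @ u, []) \<in> word_rel S R"
        using word_eq_inv[OF *(1)] by (simp add: word_rel_def)
      then have "word_rel S R `` {word_inv u @ u} = word_rel S R `` {[]}"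
        by (rule equiv_class_eq[OF equiv_word_rel])
      then show "word_rel S R `` {word_inv u} \<otimes>\<^bsub>presented_group S R\<^esub> g = \<one>\<^bsub>presented_group S R\<^esub>"
        by (simp only: *(2) presented_mult[OF word_inv_words[OF *(1)] *(1)] one)
    qed
  qed
qed


section \<open>The enveloping group and its action\<close>

definition env_relations :: "'a set \<Rightarrow> ('a \<Rightarrow> 'a \<Rightarrow> 'a) \<Rightarrow> ('a word \<times> 'a word) set" where
  "env_relations X tr =
    {([(x, True), (y, True)], [(tr x y, True), (x, True)]) | x y. x \<in> X \<and> y \<in> X}"

definition env_group :: "'a set \<Rightarrow> ('a \<Rightarrow> 'a \<Rightarrow> 'a) \<Rightarrow> 'a word set monoid" where
  "env_group X tr = presented_group X (env_relations X tr)"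

abbreviation env_class :: "'a set \<Rightarrow> ('a \<Rightarrow> 'a \<Rightarrow> 'a) \<Rightarrow> 'a word \<Rightarrow> 'a word set" where
  "env_class X tr w \<equiv> word_rel X (env_relations X tr) `` {w}"

definition env_gen :: "'a set \<Rightarrow> ('a \<Rightarrow> 'a \<Rightarrow> 'a) \<Rightarrow> 'a \<Rightarrow> 'a word set" where
  "env_gen X tr x = env_class X tr [(x, True)]"

definition letter_act :: "'a set \<Rightarrow> ('a \<Rightarrow> 'a \<Rightarrow> 'a) \<Rightarrow> 'a \<times> bool \<Rightarrow> 'a \<Rightarrow> 'a" where
  "letter_act X tr = (\<lambda>(x, b). if b then tr x else inv_into X (tr x))"

definition word_act :: "'a set \<Rightarrow> ('a \<Rightarrow> 'a \<Rightarrow> 'a) \<Rightarrow> 'a word \<Rightarrow> 'a \<Rightarrow> 'a" where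
  "word_act X tr w y = foldr (letter_act X tr) w y"

text \<open>On \<^term>\<open>X\<close>, all words representing g act in the same way (lemma \<open>env_act_class\<close> below).\<close>

definition env_act :: "'a set \<Rightarrow> ('a \<Rightarrow> 'a \<Rightarrow> 'a) \<Rightarrow> 'a word set \<Rightarrow> 'a \<Rightarrow> 'a" where
  "env_act X tr g y = the_elem ((\<lambda>w. word_act X tr w y) ` g)"

definition env_commutator :: "'a set \<Rightarrow> ('a \<Rightarrow> 'a \<Rightarrow> 'a) \<Rightarrow> 'a word set set" where
  "env_commutator X tr = derived (env_group X tr) (carrier (env_group X tr))"

definition N0_group :: "'a set \<Rightarrow> ('a \<Rightarrow> 'a \<Rightarrow> 'a) \<Rightarrow> 'a \<Rightarrow> 'a word set monoid" where
  "N0_group X tr x0 =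
    (env_group X tr)\<lparr>carrier := {n \<in> env_commutator X tr. env_act X tr n x0 = x0}\<rparr>"


section \<open>Rack cohomology\<close>

text \<open>Here and below the coefficient group \<^term>\<open>A\<close>, although written multiplicatively, is meant to be
  commutative. Functions are taken to be extensional, i.e. \<^const>\<open>undefined\<close> outside their
  intended domain, so that they are determined by their values on it.\<close>

definition rack_cocycles ::
    "'a set \<Rightarrow> ('a \<Rightarrow> 'a \<Rightarrow> 'a) \<Rightarrow> ('b, 'm) monoid_scheme \<Rightarrow> ('a \<times> 'a \<Rightarrow> 'b) set" where
  "rack_cocycles X tr A =
    {q \<in> X \<times> X \<rightarrow>\<^sub>E carrier A. \<forall>x\<in>X. \<forall>y\<in>X. \<forall>z\<in>X.
       q (tr x y, tr x z) \<otimes>\<^bsub>A\<^esub> q (x, z) = q (x, tr y z) \<otimes>\<^bsub>A\<^esub> q (y, z)}"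

definition rack_Z2 ::
    "'a set \<Rightarrow> ('a \<Rightarrow> 'a \<Rightarrow> 'a) \<Rightarrow> ('b, 'm) monoid_scheme \<Rightarrow> ('a \<times> 'a \<Rightarrow> 'b) monoid" where
  "rack_Z2 X tr A =
    \<lparr>carrier = rack_cocycles X tr A,
     mult = (\<lambda>q q'. \<lambda>p\<in>X \<times> X. q p \<otimes>\<^bsub>A\<^esub> q' p),
     one = (\<lambda>p\<in>X \<times> X. \<one>\<^bsub>A\<^esub>)\<rparr>"

definition rack_equivalent ::
    "'a set \<Rightarrow> ('a \<Rightarrow> 'a \<Rightarrow> 'a) \<Rightarrow> ('b, 'm) monoid_scheme
      \<Rightarrow> (('a \<times> 'a \<Rightarrow> 'b) \<times> ('a \<times> 'a \<Rightarrow> 'b)) set" where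
  "rack_equivalent X tr A =
    {(q, q'). q \<in> rack_cocycles X tr A \<and> q' \<in> rack_cocycles X tr A \<and>
       (\<exists>\<gamma>\<in>X \<rightarrow> carrier A. \<forall>x\<in>X. \<forall>y\<in>X.
          q' (x, y) = q (x, y) \<otimes>\<^bsub>A\<^esub> \<gamma> (tr x y) \<otimes>\<^bsub>A\<^esub> inv\<^bsub>A\<^esub> \<gamma> y)}"

text \<open>The product of two classes is their elementwise product, as in \<^const>\<open>FactGroup\<close>.\<close>

definition rack_H2 ::
    "'a set \<Rightarrow> ('a \<Rightarrow> 'a \<Rightarrow> 'a) \<Rightarrow> ('b, 'm) monoid_scheme \<Rightarrow> ('a \<times> 'a \<Rightarrow> 'b) set monoid" where
  "rack_H2 X tr A =
    \<lparr>carrier = rack_cocycles X tr A // rack_equivalent X tr A,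
     mult = set_mult (rack_Z2 X tr A),
     one = rack_equivalent X tr A `` {\<one>\<^bsub>rack_Z2 X tr A\<^esub>}\<rparr>"


section \<open>One-cocycles of the enveloping group with values in functions\<close>

definition fun_module_act ::
    "'a set \<Rightarrow> ('a \<Rightarrow> 'a \<Rightarrow> 'a) \<Rightarrow> ('a \<Rightarrow> 'b) \<Rightarrow> 'a word set \<Rightarrow> ('a \<Rightarrow> 'b)" where
  "fun_module_act X tr m g = (\<lambda>y\<in>X. m (env_act X tr g y))"

definition group_Z1 ::
    "'a set \<Rightarrow> ('a \<Rightarrow> 'a \<Rightarrow> 'a) \<Rightarrow> ('b, 'm) monoid_scheme \<Rightarrow> ('a word set \<Rightarrow> 'a \<Rightarrow> 'b) set" where
  "group_Z1 X tr A =
    {f \<in> carrier (env_group X tr) \<rightarrow>\<^sub>E (X \<rightarrow>\<^sub>E carrier A).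
      \<forall>u\<in>carrier (env_group X tr). \<forall>v\<in>carrier (env_group X tr). 
        f (u \<otimes>\<^bsub>env_group X tr\<^esub> v) = (\<lambda>y\<in>X. fun_module_act X tr (f u) v y \<otimes>\<^bsub>A\<^esub> f v y)}"

text \<open>The description is proper for every rack 2-cocycle q, see lemma \<open>ex1_cocycle_of\<close> below.\<close>

definition cocycle_of ::
    "'a set \<Rightarrow> ('a \<Rightarrow> 'a \<Rightarrow> 'a) \<Rightarrow> ('b, 'm) monoid_scheme \<Rightarrow> ('a \<times> 'a \<Rightarrow> 'b)
      \<Rightarrow> ('a word set \<Rightarrow> 'a \<Rightarrow> 'b)" where
  "cocycle_of X tr A q =
    (THE f. f \<in> group_Z1 X tr A \<and> (\<forall>x\<in>X. \<forall>y\<in>X. f (env_gen X tr x) y = q (x, y)))"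

definition restrict_N0 ::
    "'a set \<Rightarrow> ('a \<Rightarrow> 'a \<Rightarrow> 'a) \<Rightarrow> 'a \<Rightarrow> ('a word set \<Rightarrow> 'a \<Rightarrow> 'b) \<Rightarrow> ('a word set \<Rightarrow> 'b)" where
  "restrict_N0 X tr x0 f = (\<lambda>n\<in>carrier (N0_group X tr x0). f n x0)"

definition Hom_group ::
    "('g, 'k) monoid_scheme \<Rightarrow> ('b, 'm) monoid_scheme \<Rightarrow> ('g \<Rightarrow> 'b) monoid" where
  "Hom_group G A =
    \<lparr>carrier = hom G A \<inter> extensional (carrier G),
     mult = (\<lambda>h k. \<lambda>g\<in>carrier G. h g \<otimes>\<^bsub>A\<^esub> k g),
     one = (\<lambda>g\<in>carrier G. \<one>\<^bsub>A\<^esub>)\<rparr>"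


section \<open>Well-definedness of the action and of the one-cocycle of a rack cocycle\<close>

lemma group_env_group: "group (env_group X tr)"
  by (simp add: env_group_def group_presented_group)

lemma env_class_carrier: "w \<in> words X \<Longrightarrow> env_class X tr w \<in> carrier (env_group X tr)"
  by (simp add: env_group_def presented_group_def quotientI)

lemma env_carrierE:
  assumes "g \<in> carrier (env_group X tr)"
  obtains w where "w \<in> words X" "g = env_class X tr w"
  using assms by (auto simp: env_group_def presented_group_def elim!: quotientE)

lemma env_mult:
  "\<lbrakk>u \<in> words X; v \<in> words X\<rbrakk> \<Longrightarrow>
    env_class X tr u \<otimes>\<^bsub>env_group X tr\<^esub> env_class X tr v = env_class X tr (u @ v)"
  by (simp add: env_group_def presented_mult)

context rack
begin

lemma closed: "\<lbrakk>x \<in> X; y \<in> X\<rbrakk> \<Longrightarrow> x \<triangleright> y \<in> X"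
  using bij by (auto dest: bij_betwE)

lemma inv_closed: "\<lbrakk>x \<in> X; y \<in> X\<rbrakk> \<Longrightarrow> inv_into X ((\<triangleright>) x) y \<in> X"
  using bij[of x] by (auto simp: bij_betw_def intro!: inv_into_into)

lemma tr_inv: "\<lbrakk>x \<in> X; y \<in> X\<rbrakk> \<Longrightarrow> x \<triangleright> inv_into X ((\<triangleright>) x) y = y"
  using bij[of x] by (auto simp: bij_betw_def intro!: f_inv_into_f)

lemma inv_tr: "\<lbrakk>x \<in> X; y \<in> X\<rbrakk> \<Longrightarrow> inv_into X ((\<triangleright>) x) (x \<triangleright> y) = y"
  using bij[of x] by (auto simp: bij_betw_def)

lemma word_act_closed: "\<lbrakk>w \<in> words X; y \<in> X\<rbrakk> \<Longrightarrow> word_act X (\<triangleright>) w y \<in> X"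
  by (induction w) (auto simp: word_act_def letter_act_def closed inv_closed)

lemma word_act_append: "word_act X (\<triangleright>) (u @ v) y = word_act X (\<triangleright>) u (word_act X (\<triangleright>) v y)"
  by (simp add: word_act_def)

lemma word_act_eq:
  assumes "word_eq X (env_relations X (\<triangleright>)) u v" "y \<in> X"
  shows "word_act X (\<triangleright>) u y = word_act X (\<triangleright>) v y"
  using assms
proof (induction arbitrary: y rule: word_eq.induct)
  case (append u u' v v')
  then show ?case using word_eq_words[OF append.hyps(2)] word_act_closed
    by (simp add: word_act_append)
next
  case (cancel x b)
  then show ?case by (auto simp: word_act_def letter_act_def tr_inv inv_tr)
next
  case (rel u v)
  then show ?case by (auto simp: env_relations_def word_act_def letter_act_def self_distrib)
qed simp_all

lemma env_act_class:
  assumes "w \<in> words X" "y \<in> X"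
  shows "env_act X (\<triangleright>) (env_class X (\<triangleright>) w) y = word_act X (\<triangleright>) w y"
proof -
  have "(\<lambda>u. word_act X (\<triangleright>) u y) ` env_class X (\<triangleright>) w = {word_act X (\<triangleright>) w y}"
    using word_act_eq[OF _ assms(2)] word_eq.refl[OF assms(1)] by (auto simp: word_rel_def)
  then show ?thesis by (simp add: env_act_def)
qed

lemma env_act_closed:
  "\<lbrakk>g \<in> carrier (env_group X (\<triangleright>)); y \<in> X\<rbrakk> \<Longrightarrow> env_act X (\<triangleright>) g y \<in> X"
  by (metis env_carrierE env_act_class word_act_closed)

lemma env_act_mult:
  assumes "g \<in> carrier (env_group X (\<triangleright>))" "h \<in> carrier (env_group X (\<triangleright>))" "y \<in> X"
  shows "env_act X (\<triangleright>) (g \<otimes>\<^bsub>env_group X (\<triangleright>)\<^esub> h) y = env_act X (\<triangleright>) g (env_act X (\<triangleright>) h y)"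
proof -
  obtain u v where uv: "u \<in> words X" "g = env_class X (\<triangleright>) u" "v \<in> words X" "h = env_class X (\<triangleright>) v"
    using assms(1,2) by (auto elim!: env_carrierE)
  then have "u @ v \<in> words X" by simp
  then show ?thesis using uv assms(3)
    by (simp add: env_mult env_act_class word_act_closed word_act_append)
qed

lemma env_act_gen: "\<lbrakk>x \<in> X; y \<in> X\<rbrakk> \<Longrightarrow> env_act X (\<triangleright>) (env_gen X (\<triangleright>) x) y = x \<triangleright> y"
  by (simp add: env_gen_def env_act_class word_act_def letter_act_def)

end

locale rack_coeff = rack X tr + A: comm_group A
  for X :: "'a set" and tr (infixl "\<triangleright>" 70) and A :: "('b, 'm) monoid_scheme" (structure)
begin

fun word_cocycle :: "('a \<times> 'a \<Rightarrow> 'b) \<Rightarrow> 'a word \<Rightarrow> 'a \<Rightarrow> 'b" where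
  "word_cocycle q [] y = \<one>"
| "word_cocycle q ((x, b) # w) y =
    (if b then q (x, word_act X (\<triangleright>) w y)
     else inv (q (x, inv_into X ((\<triangleright>) x) (word_act X (\<triangleright>) w y)))) \<otimes> word_cocycle q w y"

lemma cocycle_closed: "\<lbrakk>q \<in> rack_cocycles X (\<triangleright>) A; x \<in> X; y \<in> X\<rbrakk> \<Longrightarrow> q (x, y) \<in> carrier A"
  by (auto simp: rack_cocycles_def)

lemma word_cocycle_closed:
  assumes q: "q \<in> rack_cocycles X (\<triangleright>) A" and y: "y \<in> X"
  shows "w \<in> words X \<Longrightarrow> word_cocycle q w y \<in> carrier A"
proof (induction w)
  case Nil
  then show ?case by simp
next
  case (Cons a w)
  obtain x b where a: "a = (x, b)" by (cases a)
  have x: "x \<in> X" "w \<in> words X" using Cons.prems a by auto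
  show ?case
    using Cons.IH[OF x(2)] word_act_closed[OF x(2) y] x
    by (simp add: a cocycle_closed[OF q] inv_closed)
qed

lemma word_cocycle_append:
  assumes "q \<in> rack_cocycles X (\<triangleright>) A" "v \<in> words X" "y \<in> X"
  shows "u \<in> words X \<Longrightarrow>
    word_cocycle q (u @ v) y = word_cocycle q u (word_act X (\<triangleright>) v y) \<otimes> word_cocycle q v y"
proof (induction u)
  case Nil
  then show ?case using word_cocycle_closed[OF assms(1,3,2)] by simp
next
  case (Cons a u)
  obtain x b where a: "a = (x, b)" by (cases a)
  have x: "x \<in> X" "u \<in> words X" using Cons.prems a by auto
  show ?case using Cons.IH[OF x(2)] x assms
    by (simp add: a word_act_append A.m_assoc cocycle_closed word_cocycle_closed word_act_closed
        inv_closed)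
qed

lemma word_cocycle_eq:
  assumes q: "q \<in> rack_cocycles X (\<triangleright>) A"
  shows "\<lbrakk>word_eq X (env_relations X (\<triangleright>)) u v; y \<in> X\<rbrakk> \<Longrightarrow> word_cocycle q u y = word_cocycle q v y"
proof (induction arbitrary: y rule: word_eq.induct)
  case (append u u' v v')
  note w = word_eq_words[OF append.hyps(1)] word_eq_words[OF append.hyps(2)]
  have "word_cocycle q u (word_act X (\<triangleright>) v y) = word_cocycle q u' (word_act X (\<triangleright>) v y)"
    using w append.prems by (intro append.IH word_act_closed) auto
  then show ?case using w append
    by (simp add: word_cocycle_append[OF q] word_act_eq[OF append.hyps(2)])
next
  case (cancel x b)
  then show ?case
    by (auto simp: word_act_def letter_act_def tr_inv inv_tr inv_closed cocycle_closed[OF q])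
next
  case (rel u v)
  from rel(1) obtain a b where ab: "a \<in> X" "b \<in> X" "u = [(a, True), (b, True)]"
    "v = [(a \<triangleright> b, True), (a, True)]" by (auto simp: env_relations_def)
  have "q (a \<triangleright> b, a \<triangleright> y) \<otimes> q (a, y) = q (a, b \<triangleright> y) \<otimes> q (b, y)"
    using q ab rel.prems by (auto simp: rack_cocycles_def)
  then show ?case using ab rel.prems
    by (simp add: word_act_def letter_act_def cocycle_closed[OF q] closed)
qed simp_all

lemma Z1_mult:
  assumes "f \<in> group_Z1 X (\<triangleright>) A" "u \<in> carrier (env_group X (\<triangleright>))"
    "v \<in> carrier (env_group X (\<triangleright>))" "y \<in> X"
  shows "f (u \<otimes>\<^bsub>env_group X (\<triangleright>)\<^esub> v) y = f u (env_act X (\<triangleright>) v y) \<otimes> f v y"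
  using assms by (simp add: group_Z1_def fun_module_act_def)

lemma Z1_one:
  assumes f: "f \<in> group_Z1 X (\<triangleright>) A" and y: "y \<in> X"
  shows "f \<one>\<^bsub>env_group X (\<triangleright>)\<^esub> y = \<one>"
proof -
  interpret G: group "env_group X (\<triangleright>)" by (rule group_env_group)
  have "\<one>\<^bsub>env_group X (\<triangleright>)\<^esub> = env_class X (\<triangleright>) []"
    by (simp add: env_group_def presented_group_def)
  then have act: "env_act X (\<triangleright>) \<one>\<^bsub>env_group X (\<triangleright>)\<^esub> y = y"
    using env_act_class[of "[]" y] y by (simp add: word_act_def)
  have fc: "f \<one>\<^bsub>env_group X (\<triangleright>)\<^esub> y \<in> carrier A"
    using f y by (auto simp: group_Z1_def PiE_iff)
  have "f \<one>\<^bsub>env_group X (\<triangleright>)\<^esub> y = f \<one>\<^bsub>env_group X (\<triangleright>)\<^esub> y \<otimes> f \<one>\<^bsub>env_group X (\<triangleright>)\<^esub> y"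
    using Z1_mult[OF f G.one_closed G.one_closed y]
    unfolding G.r_one[OF G.one_closed] act .
  then show ?thesis using A.l_cancel_one[OF fc fc] by metis
qed

lemma Z1_determined:
  assumes f: "f \<in> group_Z1 X (\<triangleright>) A"
    and fq: "\<And>x y. \<lbrakk>x \<in> X; y \<in> X\<rbrakk> \<Longrightarrow> f (env_gen X (\<triangleright>) x) y = q (x, y)"
  shows "\<lbrakk>w \<in> words X; y \<in> X\<rbrakk> \<Longrightarrow> f (env_class X (\<triangleright>) w) y = word_cocycle q w y"
proof (induction w arbitrary: y)
  case Nil
  have "\<one>\<^bsub>env_group X (\<triangleright>)\<^esub> = env_class X (\<triangleright>) []"
    by (simp add: env_group_def presented_group_def)
  with Z1_one[OF f Nil(2)] show ?case by (simp only: word_cocycle.simps)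
next
  case (Cons a w)
  obtain x b where a: "a = (x, b)" by (cases a)
  have x: "x \<in> X" and w: "w \<in> words X" using Cons.prems a by auto
  have l: "[(x, c)] \<in> words X" for c using x by simp
  have fc: "f g y \<in> carrier A" if "g \<in> carrier (env_group X (\<triangleright>))" "y \<in> X" for g y
    using f that by (auto simp: group_Z1_def PiE_iff)
  have split: "f (env_class X (\<triangleright>) (a # w)) y =
      f (env_class X (\<triangleright>) [(x, b)]) (word_act X (\<triangleright>) w y) \<otimes> word_cocycle q w y"
    using Z1_mult[OF f env_class_carrier[OF l] env_class_carrier[OF w] Cons.prems(2), of b]
      env_mult[OF l w, where tr = "(\<triangleright>)"] Cons.IH[OF w Cons.prems(2)]
    by (simp add: a env_act_class[OF w Cons.prems(2)])
  have neg: "f (env_class X (\<triangleright>) [(x, False)]) z = inv (q (x, inv_into X ((\<triangleright>) x) z))"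
    if z: "z \<in> X" for z
  proof -
    have "([(x, True), (x, \<not> True)], []) \<in> word_rel X (env_relations X (\<triangleright>))"
      unfolding word_rel_def using word_eq.cancel[OF x, where b = True] by simp
    then have "env_class X (\<triangleright>) [(x, True), (x, False)] = env_class X (\<triangleright>) []"
      using equiv_class_eq[OF equiv_word_rel] by fastforce
    also have "\<dots> = \<one>\<^bsub>env_group X (\<triangleright>)\<^esub>" by (simp add: env_group_def presented_group_def)
    finally have "f (env_class X (\<triangleright>) [(x, True)] \<otimes>\<^bsub>env_group X (\<triangleright>)\<^esub> env_class X (\<triangleright>) [(x, False)]) z
        = \<one>"
      using Z1_one[OF f z] env_mult[OF l l, where tr = "(\<triangleright>)"] by simp
    moreover have "env_act X (\<triangleright>) (env_class X (\<triangleright>) [(x, False)]) z = inv_into X ((\<triangleright>) x) z"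
      using env_act_class[OF l z] by (simp add: word_act_def letter_act_def)
    ultimately have "q (x, inv_into X ((\<triangleright>) x) z) \<otimes> f (env_class X (\<triangleright>) [(x, False)]) z = \<one>"
      using Z1_mult[OF f env_class_carrier[OF l] env_class_carrier[OF l] z]
        fq[OF x inv_closed[OF x z]] by (simp add: env_gen_def)
    moreover have "q (x, inv_into X ((\<triangleright>) x) z) \<in> carrier A"
      using fq[OF x inv_closed[OF x z]] fc[OF env_class_carrier[OF l] inv_closed[OF x z]]
      by (metis env_gen_def)
    ultimately show ?thesis
      using fc[OF env_class_carrier[OF l] z] by (metis A.inv_equality A.m_comm)
  qed
  show ?case
  proof (cases b)
    case True
    then show ?thesis
      using split fq[OF x word_act_closed[OF w Cons.prems(2)]]
      by (simp only: a env_gen_def word_cocycle.simps if_True)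
  next
    case False
    then show ?thesis
      using split neg[OF word_act_closed[OF w Cons.prems(2)]]
      by (simp only: a word_cocycle.simps if_False)
  qed
qed

lemma ex1_cocycle_of:
  assumes q: "q \<in> rack_cocycles X (\<triangleright>) A"
  shows "\<exists>!f. f \<in> group_Z1 X (\<triangleright>) A \<and> (\<forall>x\<in>X. \<forall>y\<in>X. f (env_gen X (\<triangleright>) x) y = q (x, y))"
proof (rule ex_ex1I)
  let ?f = "\<lambda>g\<in>carrier (env_group X (\<triangleright>)). \<lambda>y\<in>X. the_elem ((\<lambda>w. word_cocycle q w y) ` g)"
  have fclass: "?f (env_class X (\<triangleright>) w) y = word_cocycle q w y" if "w \<in> words X" "y \<in> X" for w y
  proof -
    have "(\<lambda>w. word_cocycle q w y) ` env_class X (\<triangleright>) w = {word_cocycle q w y}"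
      using word_cocycle_eq[OF q _ that(2)] word_eq.refl[OF that(1)]
      by (auto simp: word_rel_def image_iff)
    then show ?thesis using that by (simp add: env_class_carrier)
  qed
  show "\<exists>f. f \<in> group_Z1 X (\<triangleright>) A \<and> (\<forall>x\<in>X. \<forall>y\<in>X. f (env_gen X (\<triangleright>) x) y = q (x, y))"
  proof (intro exI[of _ ?f] conjI ballI)
    show "?f \<in> group_Z1 X (\<triangleright>) A"
      unfolding group_Z1_def
    proof (intro CollectI conjI ballI)
      have "?f g y \<in> carrier A" if "g \<in> carrier (env_group X (\<triangleright>))" "y \<in> X" for g y
      proof -
        obtain w where w: "w \<in> words X" "g = env_class X (\<triangleright>) w"
          using \<open>g \<in> _\<close> by (rule env_carrierE)
        show ?thesis
          unfolding w(2) fclass[OF w(1) \<open>y \<in> X\<close>] by (rule word_cocycle_closed[OF q \<open>y \<in> X\<close> w(1)])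
      qed
      then show "?f \<in> carrier (env_group X (\<triangleright>)) \<rightarrow>\<^sub>E (X \<rightarrow>\<^sub>E carrier A)"
        by (auto simp: PiE_iff)
      fix g h assume gh: "g \<in> carrier (env_group X (\<triangleright>))" "h \<in> carrier (env_group X (\<triangleright>))"
      obtain u v where uv: "u \<in> words X" "g = env_class X (\<triangleright>) u" "v \<in> words X"
        "h = env_class X (\<triangleright>) v" using gh by (auto elim!: env_carrierE)
      have uv': "u @ v \<in> words X" using uv by simp
      show "?f (g \<otimes>\<^bsub>env_group X (\<triangleright>)\<^esub> h) = (\<lambda>y\<in>X. fun_module_act X (\<triangleright>) (?f g) h y \<otimes> ?f h y)"
      proof (rule extensionalityI[of _ X])
        show "?f (g \<otimes>\<^bsub>env_group X (\<triangleright>)\<^esub> h) \<in> extensional X"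
          using env_class_carrier[OF uv'] uv by (simp add: env_mult)
        fix y assume y: "y \<in> X"
        show "?f (g \<otimes>\<^bsub>env_group X (\<triangleright>)\<^esub> h) y = (\<lambda>y\<in>X. fun_module_act X (\<triangleright>) (?f g) h y \<otimes> ?f h y) y"
          using fclass[OF uv' y] fclass[OF uv(3) y]
            fclass[OF uv(1) word_act_closed[OF uv(3) y]] y uv word_cocycle_append[OF q uv(3) y uv(1)]
          by (simp only: env_mult env_act_class restrict_apply' fun_module_act_def)
      qed simp
    qed
    show "?f (env_gen X (\<triangleright>) x) y = q (x, y)" if "x \<in> X" "y \<in> X" for x y
      using fclass[of "[(x, True)]" y] that cocycle_closed[OF q that]
      by (simp add: env_gen_def word_act_def)
  qed
next
  fix f f'
  assume f: "f \<in> group_Z1 X (\<triangleright>) A \<and> (\<forall>x\<in>X. \<forall>y\<in>X. f (env_gen X (\<triangleright>) x) y = q (x, y))"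
    and f': "f' \<in> group_Z1 X (\<triangleright>) A \<and> (\<forall>x\<in>X. \<forall>y\<in>X. f' (env_gen X (\<triangleright>) x) y = q (x, y))"
  have ext: "f \<in> carrier (env_group X (\<triangleright>)) \<rightarrow>\<^sub>E (X \<rightarrow>\<^sub>E carrier A)"
    "f' \<in> carrier (env_group X (\<triangleright>)) \<rightarrow>\<^sub>E (X \<rightarrow>\<^sub>E carrier A)"
    using f f' by (auto simp: group_Z1_def)
  show "f = f'"
  proof (rule PiE_ext[OF ext])
    fix g assume g: "g \<in> carrier (env_group X (\<triangleright>))"
    then obtain w where w: "w \<in> words X" "g = env_class X (\<triangleright>) w" by (rule env_carrierE)
    have fg: "f g \<in> X \<rightarrow>\<^sub>E carrier A" "f' g \<in> X \<rightarrow>\<^sub>E carrier A" using ext g by auto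
    show "f g = f' g"
    proof (rule PiE_ext[OF fg])
      fix y assume y: "y \<in> X"
      have "f g y = word_cocycle q w y"
        unfolding w(2) by (rule Z1_determined) (use f w y in auto)
      moreover have "f' g y = word_cocycle q w y"
        unfolding w(2) by (rule Z1_determined) (use f' w y in auto)
      ultimately show "f g y = f' g y" by simp
    qed
  qed
qed

end

end

theory Submission
  imports Defs "HOL-Algebra.Elementary_Groups"
begin

text \<open>
  Write \<open>A\<close> additively, \<open>G\<close> for the enveloping group, \<open>N = [G, G]\<close>, \<open>t\<close> for
  the generator of \<open>G\<close> given by \<open>x0\<close>, and \<open>f\<close> for the one-cocycle of \<open>G\<close> attached to a
  rack cocycle \<open>q\<close>. The theorem is Shapiro's lemma together with a decomposition of the stabilizer \<open>G0\<close> of \<open>x0\<close> in \<open>G\<close>.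

  Structure of \<open>G0\<close>. Conjugation by \<open>g\<close> sends the generator of \<open>y\<close> to the generator of
  \<open>g \<triangleright> y\<close> (\<open>mult_gen\<close>). Hence \<open>t\<close> commutes with every element of \<open>G0\<close>. As \<open>G\<close> acts transitively,
  all generators are conjugate to \<open>t\<close>, so \<open>G\<close> is generated by \<open>N\<close> and \<open>t\<close>. The homomorphism
  \<open>degree\<close> to the integers that sends each generator to 1 vanishes on \<open>N\<close>, so every \<open>g\<close> is uniquely
  \<open>n t\<^sup>k\<close> with \<open>n \<in> N\<close>, where \<open>k\<close> is its degree. In a quandle \<open>t\<close> fixes \<open>x0\<close>, and therefore \<open>G0\<close>
  is the direct product of \<open>N0\<close> and the infinite cyclic group of \<open>t\<close>. A homomorphism from \<open>G0\<close> to
  \<open>A\<close> is thus the same as an element of \<open>A\<close> (its value at \<open>t\<close>) together with a homomorphism on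
  \<open>N0\<close> (\<open>stab_hom_split\<close>, \<open>stab_hom_extend\<close>).

  Shapiro's lemma. For a rack cocycle \<open>q\<close>, the map \<open>F\<close> with \<open>F g = f g x0\<close> is a homomorphism on \<open>G0\<close>,
  with \<open>F t = q (x0, x0)\<close>. Choose \<open>s y \<in> G\<close> carrying \<open>x0\<close> to \<open>y\<close>. Evaluating \<open>f\<close> at
  \<open>g s(y) = s(g \<triangleright> y) l\<close>, where \<open>l = s(g \<triangleright> y)\<^sup>-\<^sup>1 g s(y)\<close> lies in \<open>G0\<close>, shows that \<open>q\<close> differs from
  \<open>(x, y) \<mapsto> F (s(x \<triangleright> y)\<^sup>-\<^sup>1 x s(y))\<close> by the coboundary of \<open>y \<mapsto> f (s y) x0\<close>
  (\<open>cocycle_of_loop\<close>). So the class of \<open>q\<close> is determined by \<open>F\<close>, and the same formula turns any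
  homomorphism \<open>F\<close> on \<open>G0\<close> into a rack cocycle with restriction \<open>F\<close>. Coboundaries
  restrict to 0 on \<open>G0\<close>, because \<open>\<gamma> (g \<triangleright> x0) - \<gamma> x0\<close> vanishes there. The first
  isomorphism theorem gives the result.
\<close>

section \<open>Group-theoretic preliminaries\<close>

lemma (in group) mult_inv_cancel [simp]:
  assumes "x \<in> carrier G" "y \<in> carrier G"
  shows "inv x \<otimes> (x \<otimes> y) = y" "x \<otimes> (inv x \<otimes> y) = y"
  using assms by (simp_all add: m_assoc[symmetric])

lemma (in group) inv_intertwine:
  assumes "x \<in> carrier G" "y \<in> carrier G" "z \<in> carrier G" "x \<otimes> y = z \<otimes> x"
  shows "inv x \<otimes> z = y \<otimes> inv x"
proof -
  have "inv x \<otimes> (z \<otimes> x) \<otimes> inv x = inv x \<otimes> (x \<otimes> y) \<otimes> inv x"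
    using assms(4) by simp
  then show ?thesis using assms(1-3) by (simp add: m_assoc)
qed

text \<open>
  This form lets cohomology classes be recognised as cosets of a kernel: a class is a fibre of the
  homomorphism, so it is enough to decide when two cocycles have the same image.
\<close>

lemma (in group_hom) kernel_coset:
  assumes y: "y \<in> carrier G"
  shows "kernel G H h #>\<^bsub>G\<^esub> y = {x \<in> carrier G. h x = h y}"
proof (intro equalityI subsetI)
  fix x assume "x \<in> kernel G H h #>\<^bsub>G\<^esub> y"
  then show "x \<in> {x \<in> carrier G. h x = h y}"
    using y by (auto simp: r_coset_def kernel_def)
next
  fix x assume "x \<in> {x \<in> carrier G. h x = h y}"
  then have x: "x \<in> carrier G" "h x = h y" by auto
  have "x \<otimes> inv y \<in> kernel G H h" using x y by (simp add: kernel_def)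
  moreover have "x = x \<otimes> inv y \<otimes> y" using x y by (simp add: G.m_assoc)
  ultimately show "x \<in> kernel G H h #>\<^bsub>G\<^esub> y" by (auto simp: r_coset_def)
qed

lemma group_Hom_group:
  assumes "group G" "comm_group A"
  shows "group (Hom_group G A)"
proof -
  interpret G: group G by fact
  interpret A: comm_group A by fact
  have val: "h g \<in> carrier A" if "h \<in> hom G A" "g \<in> carrier G" for h g
    using that by (auto simp: hom_def)
  show ?thesis
  proof (rule groupI)
    fix h k l
    assume h: "h \<in> carrier (Hom_group G A)" and k: "k \<in> carrier (Hom_group G A)"
    show "h \<otimes>\<^bsub>Hom_group G A\<^esub> k \<in> carrier (Hom_group G A)"
      using h k by (auto simp: Hom_group_def hom_def Pi_iff A.m_ac)
    assume l: "l \<in> carrier (Hom_group G A)"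
    show "h \<otimes>\<^bsub>Hom_group G A\<^esub> k \<otimes>\<^bsub>Hom_group G A\<^esub> l
        = h \<otimes>\<^bsub>Hom_group G A\<^esub> (k \<otimes>\<^bsub>Hom_group G A\<^esub> l)"
      using h k l by (auto simp: Hom_group_def val A.m_assoc intro!: restrict_ext)
  next
    show "\<one>\<^bsub>Hom_group G A\<^esub> \<in> carrier (Hom_group G A)"
      by (auto simp: Hom_group_def hom_def)
  next
    fix h assume h: "h \<in> carrier (Hom_group G A)"
    show "\<one>\<^bsub>Hom_group G A\<^esub> \<otimes>\<^bsub>Hom_group G A\<^esub> h = h"
      using h by (auto simp: Hom_group_def val fun_eq_iff extensional_def restrict_def)
    have "(\<lambda>g\<in>carrier G. inv\<^bsub>A\<^esub> h g) \<in> carrier (Hom_group G A)"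
      using h by (auto simp: Hom_group_def hom_def Pi_iff A.inv_mult)
    moreover have "(\<lambda>g\<in>carrier G. inv\<^bsub>A\<^esub> h g) \<otimes>\<^bsub>Hom_group G A\<^esub> h = \<one>\<^bsub>Hom_group G A\<^esub>"
      using h by (auto simp: Hom_group_def val intro!: restrict_ext)
    ultimately show "\<exists>k\<in>carrier (Hom_group G A). k \<otimes>\<^bsub>Hom_group G A\<^esub> h = \<one>\<^bsub>Hom_group G A\<^esub>"
      by blast
  qed
qed

section \<open>The enveloping group of a rack\<close>

context rack
begin

abbreviation "Env \<equiv> env_group X (\<triangleright>)"
abbreviation "gen \<equiv> env_gen X (\<triangleright>)"
abbreviation "act \<equiv> env_act X (\<triangleright>)"

sublocale G: group Env
  by (rule group_env_group)

lemma one_Env: "\<one>\<^bsub>Env\<^esub> = env_class X (\<triangleright>) []"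
  by (simp add: env_group_def presented_group_def)

lemma gen_carrier [simp]: "x \<in> X \<Longrightarrow> gen x \<in> carrier Env"
  unfolding env_gen_def by (rule env_class_carrier) simp

lemma act_one [simp]: "y \<in> X \<Longrightarrow> act \<one>\<^bsub>Env\<^esub> y = y"
  using env_act_class[of "[]" y] by (simp add: one_Env word_act_def)

lemma act_inv_act:
  assumes "g \<in> carrier Env" "y \<in> X"
  shows "act (inv\<^bsub>Env\<^esub> g) (act g y) = y"
  using env_act_mult[of "inv\<^bsub>Env\<^esub> g" g y] assms by simp

lemma act_act_inv:
  assumes "g \<in> carrier Env" "y \<in> X"
  shows "act g (act (inv\<^bsub>Env\<^esub> g) y) = y"
  using env_act_mult[of g "inv\<^bsub>Env\<^esub> g" y] assms by simp

lemma class_neg_letter: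
  assumes x: "x \<in> X"
  shows "env_class X (\<triangleright>) [(x, False)] = inv\<^bsub>Env\<^esub> (gen x)"
proof -
  have l: "[(x, b)] \<in> words X" for b using x by simp
  have "([(x, False), (x, \<not> False)], []) \<in> word_rel X (env_relations X (\<triangleright>))"
    unfolding word_rel_def using word_eq.cancel[OF x, where b = False] by simp
  then have "env_class X (\<triangleright>) [(x, False), (x, True)] = \<one>\<^bsub>Env\<^esub>"
    unfolding one_Env not_False_eq_True by (rule equiv_class_eq[OF equiv_word_rel])
  then have "env_class X (\<triangleright>) [(x, False)] \<otimes>\<^bsub>Env\<^esub> gen x = \<one>\<^bsub>Env\<^esub>"
    using env_mult[OF l l, where tr = "(\<triangleright>)"] by (simp add: env_gen_def)
  then show ?thesis
    using G.inv_equality[OF _ gen_carrier[OF x] env_class_carrier[OF l]] by simp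
qed

text \<open>
  Every element is represented by a word, and a word is built by putting letters in front.
  Generators and their inverses suffice as cases.
\<close>

lemma env_induct [consumes 1, case_names one gen inv_gen]:
  assumes "g \<in> carrier Env"
    and one: "P \<one>\<^bsub>Env\<^esub>"
    and gen: "\<And>x g. \<lbrakk>x \<in> X; g \<in> carrier Env; P g\<rbrakk> \<Longrightarrow> P (gen x \<otimes>\<^bsub>Env\<^esub> g)"
    and inv_gen: "\<And>x g. \<lbrakk>x \<in> X; g \<in> carrier Env; P g\<rbrakk> \<Longrightarrow> P (inv\<^bsub>Env\<^esub> (gen x) \<otimes>\<^bsub>Env\<^esub> g)"
  shows "P g"
proof -
  have "w \<in> words X \<Longrightarrow> P (env_class X (\<triangleright>) w)" for w
  proof (induction w)
    case Nil
    then show ?case using one by (simp only: one_Env)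
  next
    case (Cons a w)
    obtain x b where a: "a = (x, b)" by (cases a)
    have x: "x \<in> X" and w: "w \<in> words X" using Cons.prems a by auto
    have l: "[(x, b)] \<in> words X" using x by simp
    have "env_class X (\<triangleright>) (a # w) = env_class X (\<triangleright>) [(x, b)] \<otimes>\<^bsub>Env\<^esub> env_class X (\<triangleright>) w"
      using env_mult[OF l w, where tr = "(\<triangleright>)"] by (simp add: a)
    then show ?case
      using gen[OF x env_class_carrier[OF w] Cons.IH[OF w]]
        inv_gen[OF x env_class_carrier[OF w] Cons.IH[OF w]]
      by (cases b) (simp_all add: class_neg_letter[OF x] env_gen_def[symmetric])
  qed
  with assms(1) show ?thesis by (metis env_carrierE)
qed

lemma gen_mult_gen:
  assumes "x \<in> X" "y \<in> X"
  shows "gen x \<otimes>\<^bsub>Env\<^esub> gen y = gen (x \<triangleright> y) \<otimes>\<^bsub>Env\<^esub> gen x"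
proof -
  have l: "[(z, True)] \<in> words X" if "z \<in> X" for z using that by simp
  have "word_eq X (env_relations X (\<triangleright>)) [(x, True), (y, True)] [(x \<triangleright> y, True), (x, True)]"
    using assms closed by (intro word_eq.rel) (auto simp: env_relations_def)
  then have "env_class X (\<triangleright>) [(x, True), (y, True)] = env_class X (\<triangleright>) [(x \<triangleright> y, True), (x, True)]"
    by (intro equiv_class_eq[OF equiv_word_rel]) (simp add: word_rel_def)
  then show ?thesis
    using env_mult[OF l l, where tr = "(\<triangleright>)"] assms closed by (simp add: env_gen_def)
qed

text \<open>
  Conjugation by \<open>g\<close> carries the generator of \<open>y\<close> to that of \<open>g \<triangleright> y\<close>: for \<open>g\<close> a generator this is the
  defining relation, and the set of such \<open>g\<close> is closed under products and inverses. It makes the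
  generators along an orbit conjugate and makes the generator of \<open>y\<close> central in the stabilizer
  of \<open>y\<close>.
\<close>

lemma mult_gen:
  assumes "g \<in> carrier Env" "y \<in> X"
  shows "g \<otimes>\<^bsub>Env\<^esub> gen y = gen (act g y) \<otimes>\<^bsub>Env\<^esub> g"
  using assms
proof (induction arbitrary: y rule: env_induct)
  case one
  then show ?case by simp
next
  case (gen x g)
  have gy: "act g y \<in> X" using gen by (simp add: env_act_closed)
  have "gen x \<otimes>\<^bsub>Env\<^esub> g \<otimes>\<^bsub>Env\<^esub> gen y = gen x \<otimes>\<^bsub>Env\<^esub> gen (act g y) \<otimes>\<^bsub>Env\<^esub> g"
    using gen gy by (simp add: G.m_assoc)
  also have "\<dots> = gen (x \<triangleright> act g y) \<otimes>\<^bsub>Env\<^esub> (gen x \<otimes>\<^bsub>Env\<^esub> g)"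
    using gen gy by (subst gen_mult_gen) (simp_all add: G.m_assoc closed)
  finally show ?case
    using gen gy by (simp add: env_act_mult env_act_gen)
next
  case (inv_gen x g)
  define z where "z = act (inv\<^bsub>Env\<^esub> (gen x)) (act g y)"
  have gy: "act g y \<in> X" using inv_gen by (simp add: env_act_closed)
  have z: "z \<in> X" using inv_gen gy by (simp add: z_def env_act_closed)
  have "x \<triangleright> z = act g y"
    using act_act_inv[of "gen x" "act g y"] inv_gen gy z by (simp add: z_def[symmetric] env_act_gen)
  then have "gen x \<otimes>\<^bsub>Env\<^esub> gen z = gen (act g y) \<otimes>\<^bsub>Env\<^esub> gen x"
    using gen_mult_gen[OF inv_gen.hyps(1) z] by simp
  then have *: "inv\<^bsub>Env\<^esub> (gen x) \<otimes>\<^bsub>Env\<^esub> gen (act g y) = gen z \<otimes>\<^bsub>Env\<^esub> inv\<^bsub>Env\<^esub> (gen x)"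
    using inv_gen gy z by (intro G.inv_intertwine) simp_all
  have "inv\<^bsub>Env\<^esub> (gen x) \<otimes>\<^bsub>Env\<^esub> g \<otimes>\<^bsub>Env\<^esub> gen y
      = inv\<^bsub>Env\<^esub> (gen x) \<otimes>\<^bsub>Env\<^esub> gen (act g y) \<otimes>\<^bsub>Env\<^esub> g"
    using inv_gen gy by (simp add: G.m_assoc)
  also have "\<dots> = gen z \<otimes>\<^bsub>Env\<^esub> (inv\<^bsub>Env\<^esub> (gen x) \<otimes>\<^bsub>Env\<^esub> g)"
    unfolding * using inv_gen z by (simp add: G.m_assoc)
  finally show ?case
    using inv_gen gy by (simp add: z_def env_act_mult)
qed

definition word_degree :: "'a word \<Rightarrow> int" where
  "word_degree w = (\<Sum>(x, b)\<leftarrow>w. if b then 1 else - 1)"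

definition degree :: "'a word set \<Rightarrow> int" where
  "degree g = the_elem (word_degree ` g)"

text \<open>
  Both sides of a defining relation have two positive letters and an inverse pair has sum 0, so the exponent
  sum of a word is an invariant of the group element it represents.
\<close>

lemma word_degree_eq:
  "word_eq X (env_relations X (\<triangleright>)) u v \<Longrightarrow> word_degree u = word_degree v"
  by (induction rule: word_eq.induct) (auto simp: word_degree_def env_relations_def)

lemma degree_class:
  assumes "w \<in> words X"
  shows "degree (env_class X (\<triangleright>) w) = word_degree w"
proof -
  have "word_degree ` env_class X (\<triangleright>) w = {word_degree w}"
    using word_degree_eq word_eq.refl[OF assms] by (auto simp: word_rel_def)
  then show ?thesis by (simp add: degree_def)
qed

lemma degree_hom: "degree \<in> hom Env integer_group"
proof (rule homI)
  fix g h assume "g \<in> carrier Env" "h \<in> carrier Env"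
  then obtain u v where uv: "u \<in> words X" "g = env_class X (\<triangleright>) u" "v \<in> words X"
    "h = env_class X (\<triangleright>) v" by (auto elim!: env_carrierE)
  moreover have "u @ v \<in> words X" using uv by simp
  ultimately show "degree (g \<otimes>\<^bsub>Env\<^esub> h) = degree g \<otimes>\<^bsub>integer_group\<^esub> degree h"
    by (simp only: env_mult degree_class mult_integer_group) (simp add: word_degree_def)
qed simp

sublocale degree: group_hom Env integer_group degree
  by (simp add: group_hom_def group_hom_axioms_def degree_hom G.group_axioms)

lemma degree_mult:
  "\<lbrakk>g \<in> carrier Env; h \<in> carrier Env\<rbrakk> \<Longrightarrow> degree (g \<otimes>\<^bsub>Env\<^esub> h) = degree g + degree h"
  using degree.hom_mult by simp

lemma degree_inv: "g \<in> carrier Env \<Longrightarrow> degree (inv\<^bsub>Env\<^esub> g) = - degree g"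
  using degree.hom_inv by simp

lemma degree_gen: "x \<in> X \<Longrightarrow> degree (gen x) = 1"
  unfolding env_gen_def by (subst degree_class) (simp_all add: word_degree_def)

lemma degree_commutator:
  assumes "n \<in> env_commutator X (\<triangleright>)"
  shows "degree n = 0"
proof -
  have "env_commutator X (\<triangleright>) \<subseteq> kernel Env integer_group degree"
    unfolding env_commutator_def derived_def
    by (intro G.generate_subgroup_incl degree.subgroup_kernel)
      (auto simp: kernel_def degree_mult degree_inv)
  with assms show ?thesis by (auto simp: kernel_def)
qed

end

section \<open>The stabilizer of the base point\<close>

locale indecomposable_quandle = quandle X tr
  for X :: "'a set" and tr (infixl "\<triangleright>" 70) +
  fixes x0 :: 'a
  assumes indec: "indecomposable X (\<triangleright>)" and x0: "x0 \<in> X"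
begin

abbreviation "N \<equiv> env_commutator X (\<triangleright>)"
abbreviation "t \<equiv> gen x0"

sublocale N: normal N Env
  unfolding env_commutator_def by (rule G.derived_self_is_normal)

text \<open>
  The inner group is the image of the enveloping group in the permutations of \<open>X\<close>; hence
  indecomposability says that the enveloping group acts transitively.
\<close>

lemma inner_group_act:
  assumes "f \<in> inner_group X (\<triangleright>)"
  shows "\<exists>g\<in>carrier Env. \<forall>y\<in>X. f y = act g y"
  using assms unfolding inner_group_def
proof (induction rule: generate.induct)
  case one
  then show ?case by (intro bexI[of _ "\<one>\<^bsub>Env\<^esub>"]) (auto simp: BijGroup_def)
next
  case (incl h)
  then obtain x where "x \<in> X" "h = (\<lambda>y\<in>X. x \<triangleright> y)" by auto
  then show ?case by (intro bexI[of _ "gen x"]) (auto simp: env_act_gen)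
next
  case (inv h)
  then obtain x where x: "x \<in> X" and h: "h = (\<lambda>y\<in>X. x \<triangleright> y)" by auto
  have hb: "bij_betw h X X" using bij[OF x] unfolding h by (rule bij_betw_restrict_eq[THEN iffD2])
  then have "h \<in> Bij X" by (auto simp: Bij_def h)
  moreover have "inv_into X h y = act (inv\<^bsub>Env\<^esub> (gen x)) y" if y: "y \<in> X" for y
  proof -
    have z: "act (inv\<^bsub>Env\<^esub> (gen x)) y \<in> X" using x y by (simp add: env_act_closed)
    have "h (act (inv\<^bsub>Env\<^esub> (gen x)) y) = y"
      using act_act_inv[of "gen x" y] x y z by (simp add: h env_act_gen)
    then show ?thesis using inv_into_f_eq[of h X] hb z by (auto simp: bij_betw_def)
  qed
  ultimately show ?case using x
    by (intro bexI[of _ "inv\<^bsub>Env\<^esub> (gen x)"]) (auto simp: inv_BijGroup)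
next
  case (eng h1 h2)
  interpret B: group "BijGroup X" by (rule group_BijGroup)
  have "(\<lambda>x. \<lambda>y\<in>X. x \<triangleright> y) ` X \<subseteq> carrier (BijGroup X)"
    using bij by (auto simp: BijGroup_def Bij_def bij_betw_restrict_eq)
  then have "h1 \<in> carrier (BijGroup X)" "h2 \<in> carrier (BijGroup X)"
    using B.generate_in_carrier eng.hyps by blast+
  then have h: "h1 \<in> Bij X" "h2 \<in> Bij X" by (simp_all add: BijGroup_def)
  obtain g1 g2 where g: "g1 \<in> carrier Env" "g2 \<in> carrier Env"
    "\<forall>y\<in>X. h1 y = act g1 y" "\<forall>y\<in>X. h2 y = act g2 y" using eng.IH by auto
  then show ?case using h
    by (intro bexI[of _ "g1 \<otimes>\<^bsub>Env\<^esub> g2"])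
      (auto simp: BijGroup_def compose_def env_act_mult env_act_closed)
qed

lemma transitive:
  assumes "y \<in> X"
  shows "\<exists>g\<in>carrier Env. act g x0 = y"
proof -
  obtain f where "f \<in> inner_group X (\<triangleright>)" "f x0 = y"
    using indec x0 assms by (auto simp: indecomposable_def)
  with inner_group_act x0 show ?thesis by metis
qed

definition transport :: "'a \<Rightarrow> 'a word set" where
  "transport y = (SOME g. g \<in> carrier Env \<and> act g x0 = y)"

lemma transport:
  assumes "y \<in> X"
  shows "transport y \<in> carrier Env" "act (transport y) x0 = y"
proof -
  have "transport y \<in> carrier Env \<and> act (transport y) x0 = y"
    unfolding transport_def by (rule someI_ex) (use transitive[OF assms] in blast)
  then show "transport y \<in> carrier Env" "act (transport y) x0 = y" by auto
qed

text \<open>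
  The generator of \<open>x\<close> is a conjugate \<open>g t g\<^sup>-\<^sup>1\<close>, which differs from \<open>t\<close> by the commutator of
  \<open>g\<close> and \<open>t\<close>.
\<close>

lemma gen_base_coset:
  assumes x: "x \<in> X"
  shows "\<exists>c\<in>N. gen x = c \<otimes>\<^bsub>Env\<^esub> t"
proof -
  let ?g = "transport x"
  note g = transport[OF x] gen_carrier[OF x0] gen_carrier[OF x]
  have "gen x = ?g \<otimes>\<^bsub>Env\<^esub> t \<otimes>\<^bsub>Env\<^esub> inv\<^bsub>Env\<^esub> ?g"
    using mult_gen[OF g(1) x0] g by (simp add: G.m_assoc)
  also have "\<dots> = (?g \<otimes>\<^bsub>Env\<^esub> t \<otimes>\<^bsub>Env\<^esub> inv\<^bsub>Env\<^esub> ?g \<otimes>\<^bsub>Env\<^esub> inv\<^bsub>Env\<^esub> t) \<otimes>\<^bsub>Env\<^esub> t"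
    using g by (simp add: G.m_assoc)
  finally have "gen x = \<dots>" .
  moreover have "?g \<otimes>\<^bsub>Env\<^esub> t \<otimes>\<^bsub>Env\<^esub> inv\<^bsub>Env\<^esub> ?g \<otimes>\<^bsub>Env\<^esub> inv\<^bsub>Env\<^esub> t \<in> N"
    unfolding env_commutator_def derived_def by (rule generate.incl) (use g in blast)
  ultimately show ?thesis by blast
qed

text \<open>
  The factor \<open>n\<close> in \<open>g = n t\<^sup>k\<close>, where the exponent \<open>k\<close> is forced to be the degree of \<open>g\<close>.
\<close>

definition commutator_part :: "'a word set \<Rightarrow> 'a word set" where
  "commutator_part g = g \<otimes>\<^bsub>Env\<^esub> t [^]\<^bsub>Env\<^esub> (- degree g)"

lemma t_carrier [simp]: "t \<in> carrier Env"
  using x0 by simp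

text \<open>
  Modulo the commutator subgroup every generator equals \<open>t\<close>. In the induction step, the new letter
  \<open>c t\<close> with \<open>c \<in> N\<close> contributes \<open>c\<close> and a conjugation by \<open>t\<close>, and \<open>N\<close> is normal.
\<close>

lemma commutator_part_N: "g \<in> carrier Env \<Longrightarrow> commutator_part g \<in> N"
proof (induction rule: env_induct)
  case one
  have "degree \<one>\<^bsub>Env\<^esub> = 0" using degree.hom_one by simp
  then show ?case by (simp add: commutator_part_def)
next
  case (gen x g)
  obtain c where c: "c \<in> N" "gen x = c \<otimes>\<^bsub>Env\<^esub> t" using gen_base_coset[OF gen.hyps(1)] by blast
  note cN = N.mem_carrier[OF c(1)]
  have "commutator_part (gen x \<otimes>\<^bsub>Env\<^esub> g)
      = c \<otimes>\<^bsub>Env\<^esub> (t \<otimes>\<^bsub>Env\<^esub> commutator_part g \<otimes>\<^bsub>Env\<^esub> inv\<^bsub>Env\<^esub> t)"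
  proof -
    have "t [^]\<^bsub>Env\<^esub> (- degree (gen x \<otimes>\<^bsub>Env\<^esub> g)) = t [^]\<^bsub>Env\<^esub> (- degree g) \<otimes>\<^bsub>Env\<^esub> inv\<^bsub>Env\<^esub> t"
      using gen G.int_pow_mult[OF t_carrier, of "- degree g" "-1"]
      by (simp add: degree_mult degree_gen G.int_pow_neg algebra_simps)
    then show ?thesis using gen cN by (simp add: commutator_part_def c(2) G.m_assoc)
  qed
  then show ?case using c(1) N.inv_op_closed2[OF t_carrier gen.IH] by simp
next
  case (inv_gen x g)
  obtain c where c: "c \<in> N" "gen x = c \<otimes>\<^bsub>Env\<^esub> t"
    using gen_base_coset[OF inv_gen.hyps(1)] by blast
  note cN = N.mem_carrier[OF c(1)]
  have "commutator_part (inv\<^bsub>Env\<^esub> (gen x) \<otimes>\<^bsub>Env\<^esub> g)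
      = inv\<^bsub>Env\<^esub> t \<otimes>\<^bsub>Env\<^esub> (inv\<^bsub>Env\<^esub> c \<otimes>\<^bsub>Env\<^esub> commutator_part g) \<otimes>\<^bsub>Env\<^esub> t"
  proof -
    have "t [^]\<^bsub>Env\<^esub> (- degree (inv\<^bsub>Env\<^esub> (gen x) \<otimes>\<^bsub>Env\<^esub> g)) = t [^]\<^bsub>Env\<^esub> (- degree g) \<otimes>\<^bsub>Env\<^esub> t"
      using inv_gen G.int_pow_mult[OF t_carrier, of "- degree g" 1]
      by (simp add: degree_mult degree_gen degree_inv)
    then show ?thesis using inv_gen cN by (simp add: commutator_part_def c(2) G.m_assoc G.inv_mult_group)
  qed
  then show ?case using c(1) inv_gen.IH N.inv_op_closed1[OF t_carrier, of "inv\<^bsub>Env\<^esub> c \<otimes>\<^bsub>Env\<^esub> commutator_part g"]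
    by simp
qed

definition stab :: "'a word set monoid" where
  "stab = Env\<lparr>carrier := {g \<in> carrier Env. act g x0 = x0}\<rparr>"

lemma stab_simps [simp]:
  "carrier stab = {g \<in> carrier Env. act g x0 = x0}"
  "g \<otimes>\<^bsub>stab\<^esub> h = g \<otimes>\<^bsub>Env\<^esub> h" "\<one>\<^bsub>stab\<^esub> = \<one>\<^bsub>Env\<^esub>"
  by (simp_all add: stab_def)

abbreviation "N0 \<equiv> N0_group X (\<triangleright>) x0"

lemma N0_simps [simp]:
  "carrier N0 = {n \<in> N. act n x0 = x0}"
  "g \<otimes>\<^bsub>N0\<^esub> h = g \<otimes>\<^bsub>Env\<^esub> h" "\<one>\<^bsub>N0\<^esub> = \<one>\<^bsub>Env\<^esub>"
  by (simp_all add: N0_group_def)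

lemma act_inv_fixed:
  assumes "g \<in> carrier Env" "act g x0 = x0"
  shows "act (inv\<^bsub>Env\<^esub> g) x0 = x0"
  using act_inv_act[OF assms(1) x0] assms(2) by simp

lemma subgroup_stab: "subgroup {g \<in> carrier Env. act g x0 = x0} Env"
  using x0 by (intro subgroup.intro) (auto simp: env_act_mult act_inv_fixed)

lemma group_stab: "group stab"
  unfolding stab_def by (rule G.subgroup_imp_group[OF subgroup_stab])

lemma group_N0: "group N0"
  unfolding N0_group_def
proof (rule G.subgroup_imp_group)
  show "subgroup {n \<in> N. act n x0 = x0} Env"
    using x0 by (intro subgroup.intro) (auto simp: env_act_mult act_inv_fixed N.mem_carrier)
qed

lemma t_stab: "t \<in> carrier stab"
  using x0 by (simp add: env_act_gen idem)

lemma stab_pow: "g \<in> carrier stab \<Longrightarrow> g [^]\<^bsub>stab\<^esub> (k::int) = g [^]\<^bsub>Env\<^esub> k"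
  using G.int_pow_consistent[OF subgroup_stab, of g k] by (simp add: stab_def)

lemma pow_t_stab: "t [^]\<^bsub>Env\<^esub> (k::int) \<in> carrier stab"
  using group.int_pow_closed[OF group_stab t_stab, of k] unfolding stab_pow[OF t_stab] .

text \<open>
  By \<open>mult_gen\<close>, conjugating \<open>t\<close> by \<open>g\<close> gives the generator of \<open>g \<triangleright> x0\<close>, which is \<open>t\<close> itself when
  \<open>g\<close> fixes \<open>x0\<close>.
\<close>

lemma stab_commutes_pow:
  assumes "g \<in> carrier stab"
  shows "t [^]\<^bsub>Env\<^esub> (k::int) \<otimes>\<^bsub>Env\<^esub> g = g \<otimes>\<^bsub>Env\<^esub> t [^]\<^bsub>Env\<^esub> k"
proof -
  have g: "g \<in> carrier Env" and gx: "act g x0 = x0" using assms by simp_all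
  have tg: "t \<otimes>\<^bsub>Env\<^esub> g = g \<otimes>\<^bsub>Env\<^esub> t"
    using mult_gen[OF g x0] unfolding gx by (simp only:)
  have pos: "t [^]\<^bsub>Env\<^esub> (n::nat) \<otimes>\<^bsub>Env\<^esub> g = g \<otimes>\<^bsub>Env\<^esub> t [^]\<^bsub>Env\<^esub> n" for n
    by (rule G.group_commutes_pow[OF tg t_carrier g])
  have neg: "inv\<^bsub>Env\<^esub> (t [^]\<^bsub>Env\<^esub> (n::nat)) \<otimes>\<^bsub>Env\<^esub> g = g \<otimes>\<^bsub>Env\<^esub> inv\<^bsub>Env\<^esub> (t [^]\<^bsub>Env\<^esub> n)" for n
    by (rule G.inv_intertwine[OF _ g g pos]) simp
  show ?thesis
  proof (cases "k < 0")
    case True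
    then have "t [^]\<^bsub>Env\<^esub> k = inv\<^bsub>Env\<^esub> (t [^]\<^bsub>Env\<^esub> nat (- k))"
      using int_pow_def2[of Env t k] by simp
    then show ?thesis using neg by (simp only:)
  next
    case False
    then have "t [^]\<^bsub>Env\<^esub> k = t [^]\<^bsub>Env\<^esub> nat k"
      using int_pow_def2[of Env t k] by simp
    then show ?thesis using pos by (simp only:)
  qed
qed

lemma commutator_part_stab: "g \<in> carrier stab \<Longrightarrow> commutator_part g \<in> carrier N0"
  using commutator_part_N pow_t_stab[of "- degree g"] x0 by (simp add: commutator_part_def env_act_mult)

text \<open>
  Together with \<open>commutator_part_split\<close>, this makes the stabilizer of \<open>x0\<close> the direct product of
  \<open>N0\<close> and the powers of \<open>t\<close>. The projection is multiplicative because \<open>t\<close> is central in the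
  stabilizer.
\<close>

lemma commutator_part_mult:
  assumes g: "g \<in> carrier stab" and h: "h \<in> carrier stab"
  shows "commutator_part (g \<otimes>\<^bsub>Env\<^esub> h) = commutator_part g \<otimes>\<^bsub>Env\<^esub> commutator_part h"
proof -
  have gh: "g \<in> carrier Env" "h \<in> carrier Env" using g h by auto
  have "commutator_part (g \<otimes>\<^bsub>Env\<^esub> h)
      = g \<otimes>\<^bsub>Env\<^esub> (h \<otimes>\<^bsub>Env\<^esub> t [^]\<^bsub>Env\<^esub> (- degree g)) \<otimes>\<^bsub>Env\<^esub> t [^]\<^bsub>Env\<^esub> (- degree h)"
    using gh G.int_pow_mult[OF t_carrier, of "- degree g" "- degree h"]
    by (simp add: commutator_part_def degree_mult G.m_assoc)
  then show ?thesis
    using gh by (simp add: commutator_part_def stab_commutes_pow[OF h, symmetric] G.m_assoc)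
qed

lemma commutator_part_split:
  assumes "g \<in> carrier Env"
  shows "g = commutator_part g \<otimes>\<^bsub>Env\<^esub> t [^]\<^bsub>Env\<^esub> degree g"
  using assms by (simp add: commutator_part_def G.m_assoc G.int_pow_mult[OF t_carrier, symmetric])

lemma commutator_part_ident: "n \<in> N \<Longrightarrow> commutator_part n = n"
  by (simp add: commutator_part_def degree_commutator N.mem_carrier)

lemma commutator_part_t: "commutator_part t = \<one>\<^bsub>Env\<^esub>"
  using x0 by (simp add: commutator_part_def degree_gen G.int_pow_neg)

lemma transport_stab:
  assumes "g \<in> carrier Env" "y \<in> X"
  shows "inv\<^bsub>Env\<^esub> (transport (act g y)) \<otimes>\<^bsub>Env\<^esub> g \<otimes>\<^bsub>Env\<^esub> transport y \<in> carrier stab"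
proof -
  note gy = env_act_closed[OF assms]
  have "act (inv\<^bsub>Env\<^esub> (transport (act g y)) \<otimes>\<^bsub>Env\<^esub> g \<otimes>\<^bsub>Env\<^esub> transport y) x0
      = act (inv\<^bsub>Env\<^esub> (transport (act g y))) (act g y)"
    using assms x0 gy by (simp add: env_act_mult transport env_act_closed)
  also have "\<dots> = x0"
    using act_inv_act[OF transport(1)[OF gy] x0] by (simp add: transport(2)[OF gy])
  finally show ?thesis using assms gy by (simp add: transport)
qed

end

section \<open>One-cocycles and rack cocycles\<close>

context rack_coeff
begin

abbreviation "Z2 \<equiv> rack_cocycles X (\<triangleright>) A"
abbreviation "\<ff> \<equiv> cocycle_of X (\<triangleright>) A"

lemma cocycle_of_Z1:
  assumes "q \<in> Z2"
  shows "\<ff> q \<in> group_Z1 X (\<triangleright>) A"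
    and "\<lbrakk>x \<in> X; y \<in> X\<rbrakk> \<Longrightarrow> \<ff> q (gen x) y = q (x, y)"
  using theI'[OF ex1_cocycle_of[OF assms]] by (auto simp: cocycle_of_def)

lemma cocycle_of_closed:
  "\<lbrakk>q \<in> Z2; g \<in> carrier Env; y \<in> X\<rbrakk> \<Longrightarrow> \<ff> q g y \<in> carrier A"
  using cocycle_of_Z1(1)[of q] by (auto simp: group_Z1_def PiE_iff)

lemma cocycle_of_mult:
  "\<lbrakk>q \<in> Z2; g \<in> carrier Env; h \<in> carrier Env; y \<in> X\<rbrakk> \<Longrightarrow>
    \<ff> q (g \<otimes>\<^bsub>Env\<^esub> h) y = \<ff> q g (act h y) \<otimes> \<ff> q h y"
  by (rule Z1_mult[OF cocycle_of_Z1(1)])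

text \<open>
  Values of the one-cocycle of \<open>q\<close> are computed by exhibiting any crossed homomorphism with the
  right values on generators: uniqueness of the one-cocycle does the rest.
\<close>

lemma cocycle_of_eqI:
  assumes q: "q \<in> Z2"
    and closed: "\<And>g y. \<lbrakk>g \<in> carrier Env; y \<in> X\<rbrakk> \<Longrightarrow> \<phi> g y \<in> carrier A"
    and crossed: "\<And>g h y. \<lbrakk>g \<in> carrier Env; h \<in> carrier Env; y \<in> X\<rbrakk> \<Longrightarrow>
      \<phi> (g \<otimes>\<^bsub>Env\<^esub> h) y = \<phi> g (act h y) \<otimes> \<phi> h y"
    and gens: "\<And>x y. \<lbrakk>x \<in> X; y \<in> X\<rbrakk> \<Longrightarrow> \<phi> (gen x) y = q (x, y)"
    and g: "g \<in> carrier Env" and y: "y \<in> X"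
  shows "\<ff> q g y = \<phi> g y"
proof -
  define f where "f = (\<lambda>g\<in>carrier Env. \<lambda>y\<in>X. \<phi> g y)"
  have "f \<in> group_Z1 X (\<triangleright>) A"
    unfolding group_Z1_def f_def fun_module_act_def
    using closed crossed by (auto simp: env_act_closed intro!: restrict_ext)
  moreover have "\<forall>x\<in>X. \<forall>y\<in>X. f (gen x) y = q (x, y)"
    using gens by (simp add: f_def)
  ultimately have "\<ff> q = f"
    unfolding cocycle_of_def by (intro the1_equality[OF ex1_cocycle_of[OF q]] conjI)
  then show ?thesis using g y by (simp add: f_def)
qed

text \<open>
  The rack cocycle condition is what one gets by evaluating a crossed homomorphism on the two sides of
  the defining relation \<open>x y = (x \<triangleright> y) x\<close>.
\<close>

lemma crossed_rack_cocycle: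
  assumes closed': "\<And>g y. \<lbrakk>g \<in> carrier Env; y \<in> X\<rbrakk> \<Longrightarrow> \<phi> g y \<in> carrier A"
    and crossed: "\<And>g h y. \<lbrakk>g \<in> carrier Env; h \<in> carrier Env; y \<in> X\<rbrakk> \<Longrightarrow>
      \<phi> (g \<otimes>\<^bsub>Env\<^esub> h) y = \<phi> g (act h y) \<otimes> \<phi> h y"
  shows "(\<lambda>(x, y)\<in>X \<times> X. \<phi> (gen x) y) \<in> Z2"
proof -
  have "\<phi> (gen (x \<triangleright> y)) (x \<triangleright> z) \<otimes> \<phi> (gen x) z = \<phi> (gen x) (y \<triangleright> z) \<otimes> \<phi> (gen y) z"
    if "x \<in> X" "y \<in> X" "z \<in> X" for x y z
    using crossed[of "gen (x \<triangleright> y)" "gen x" z] crossed[of "gen x" "gen y" z] that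
      gen_mult_gen[of x y] by (simp add: closed env_act_gen)
  then show ?thesis
    by (auto simp: rack_cocycles_def closed closed')
qed

lemma rack_Z2_simps [simp]:
  "carrier (rack_Z2 X (\<triangleright>) A) = Z2"
  "q \<otimes>\<^bsub>rack_Z2 X (\<triangleright>) A\<^esub> q' = (\<lambda>p\<in>X \<times> X. q p \<otimes> q' p)"
  "\<one>\<^bsub>rack_Z2 X (\<triangleright>) A\<^esub> = (\<lambda>p\<in>X \<times> X. \<one>)"
  by (simp_all add: rack_Z2_def)

lemma cocycle_identity:
  "\<lbrakk>q \<in> Z2; x \<in> X; y \<in> X; z \<in> X\<rbrakk> \<Longrightarrow>
    q (x \<triangleright> y, x \<triangleright> z) \<otimes> q (x, z) = q (x, y \<triangleright> z) \<otimes> q (y, z)"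
  by (simp add: rack_cocycles_def)

lemma prod_cocycle:
  assumes q: "q \<in> Z2" "q' \<in> Z2"
  shows "(\<lambda>p\<in>X \<times> X. q p \<otimes> q' p) \<in> Z2"
proof -
  have "q (x \<triangleright> y, x \<triangleright> z) \<otimes> q' (x \<triangleright> y, x \<triangleright> z) \<otimes> (q (x, z) \<otimes> q' (x, z))
      = q (x, y \<triangleright> z) \<otimes> q' (x, y \<triangleright> z) \<otimes> (q (y, z) \<otimes> q' (y, z))"
    if "x \<in> X" "y \<in> X" "z \<in> X" for x y z
  proof -
    have "q (x \<triangleright> y, x \<triangleright> z) \<otimes> q' (x \<triangleright> y, x \<triangleright> z) \<otimes> (q (x, z) \<otimes> q' (x, z))
        = (q (x \<triangleright> y, x \<triangleright> z) \<otimes> q (x, z)) \<otimes> (q' (x \<triangleright> y, x \<triangleright> z) \<otimes> q' (x, z))"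
      using that q by (simp add: A.m_ac cocycle_closed closed)
    also have "\<dots> = (q (x, y \<triangleright> z) \<otimes> q (y, z)) \<otimes> (q' (x, y \<triangleright> z) \<otimes> q' (y, z))"
      by (simp only: cocycle_identity[OF q(1) that] cocycle_identity[OF q(2) that])
    also have "\<dots> = q (x, y \<triangleright> z) \<otimes> q' (x, y \<triangleright> z) \<otimes> (q (y, z) \<otimes> q' (y, z))"
      using that q by (simp add: A.m_ac cocycle_closed closed)
    finally show ?thesis .
  qed
  then show ?thesis using q by (auto simp: rack_cocycles_def closed)
qed

lemma inv_cocycle:
  assumes q: "q \<in> Z2"
  shows "(\<lambda>p\<in>X \<times> X. inv (q p)) \<in> Z2"
proof -
  have "inv (q (x \<triangleright> y, x \<triangleright> z)) \<otimes> inv (q (x, z)) = inv (q (x, y \<triangleright> z)) \<otimes> inv (q (y, z))"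
    if "x \<in> X" "y \<in> X" "z \<in> X" for x y z
    using cocycle_identity[OF q that] that q
    by (simp add: A.inv_mult[symmetric] cocycle_closed closed)
  then show ?thesis using q by (auto simp: rack_cocycles_def closed)
qed

lemma group_rack_Z2: "group (rack_Z2 X (\<triangleright>) A)"
proof (rule groupI, unfold rack_Z2_simps)
  have ext: "q \<in> X \<times> X \<rightarrow>\<^sub>E carrier A" if "q \<in> Z2" for q
    using that by (simp add: rack_cocycles_def)
  fix q q' q'' assume q: "q \<in> Z2"
  {
    assume q': "q' \<in> Z2"
    show "(\<lambda>p\<in>X \<times> X. q p \<otimes> q' p) \<in> Z2"
      by (rule prod_cocycle[OF q q'])
    assume q'': "q'' \<in> Z2"
    show "(\<lambda>p\<in>X \<times> X. (\<lambda>p\<in>X \<times> X. q p \<otimes> q' p) p \<otimes> q'' p)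
        = (\<lambda>p\<in>X \<times> X. q p \<otimes> (\<lambda>p\<in>X \<times> X. q' p \<otimes> q'' p) p)"
      using q q' q'' by (auto simp: A.m_assoc cocycle_closed intro!: restrict_ext)
  }
  show "(\<lambda>p\<in>X \<times> X. (\<lambda>p\<in>X \<times> X. \<one>) p \<otimes> q p) = q"
    using q ext[OF q] by (intro extensionalityI[of _ "X \<times> X"]) (auto simp: cocycle_closed PiE_def)
  show "\<exists>r\<in>Z2. (\<lambda>p\<in>X \<times> X. r p \<otimes> q p) = (\<lambda>p\<in>X \<times> X. \<one>)"
    using q by (intro bexI[OF _ inv_cocycle[OF q]]) (auto simp: cocycle_closed intro!: restrict_ext)
qed (auto simp: rack_cocycles_def closed)

lemma cocycle_of_prod:
  assumes q: "q \<in> Z2" "q' \<in> Z2" and g: "g \<in> carrier Env" and y: "y \<in> X"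
  shows "\<ff> (\<lambda>p\<in>X \<times> X. q p \<otimes> q' p) g y = \<ff> q g y \<otimes> \<ff> q' g y"
  by (rule cocycle_of_eqI[OF prod_cocycle[OF q], where \<phi> = "\<lambda>g y. \<ff> q g y \<otimes> \<ff> q' g y"])
    (use q g y in \<open>simp_all add: cocycle_of_mult cocycle_of_closed cocycle_of_Z1(2) env_act_closed A.m_ac\<close>)

end

section \<open>Shapiro's lemma for the stabilizer of the base point\<close>

locale rack_cohomology = indecomposable_quandle X tr x0 + rack_coeff X tr A
  for X :: "'a set" and tr (infixl "\<triangleright>" 70) and x0 :: 'a
    and A :: "('b, 'm) monoid_scheme" (structure)
begin

text \<open>
  On the stabilizer of \<open>x0\<close> the action in the crossed homomorphism identity disappears.
\<close>

lemma cocycle_of_stab_hom: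
  assumes "q \<in> Z2"
  shows "(\<lambda>g. \<ff> q g x0) \<in> hom stab A"
  using assms x0 by (intro homI) (auto simp: cocycle_of_mult cocycle_of_closed)

lemma stab_hom_split:
  assumes F: "F \<in> hom stab A" and g: "g \<in> carrier stab"
  shows "F g = F (commutator_part g) \<otimes> F t [^] degree g"
proof -
  interpret F: group_hom stab A F
    by (simp add: group_hom_def group_hom_axioms_def F group_stab A.is_group)
  have n: "commutator_part g \<in> carrier stab" using commutator_part_stab[OF g] by (simp add: N.mem_carrier)
  have "F g = F (commutator_part g \<otimes>\<^bsub>stab\<^esub> t [^]\<^bsub>Env\<^esub> degree g)"
    using commutator_part_split[of g] g by simp
  also have "\<dots> = F (commutator_part g) \<otimes> F (t [^]\<^bsub>Env\<^esub> degree g)"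
    by (rule F.hom_mult[OF n pow_t_stab])
  also have "F (t [^]\<^bsub>Env\<^esub> degree g) = F t [^] degree g"
    using F.hom_int_pow[OF t_stab, of "degree g"] unfolding stab_pow[OF t_stab] .
  finally show ?thesis .
qed

text \<open>
  Elements of \<open>A\<close> and homomorphisms on \<open>N0\<close> can be prescribed independently, because the
  stabilizer is a direct product and \<open>t\<close> has infinite order, as detected by the degree.
\<close>

lemma stab_hom_extend:
  assumes h: "h \<in> hom N0 A" and a: "a \<in> carrier A"
  shows "(\<lambda>g. h (commutator_part g) \<otimes> a [^] degree g) \<in> hom stab A"
proof (rule homI)
  have hc: "h n \<in> carrier A" if "n \<in> carrier N0" for n using h that by (auto simp: hom_def)
  fix g k assume g: "g \<in> carrier stab" and k: "k \<in> carrier stab"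
  note n = commutator_part_stab[OF g] commutator_part_stab[OF k]
  show "h (commutator_part g) \<otimes> a [^] degree g \<in> carrier A" using hc[OF n(1)] a by simp
  have "h (commutator_part (g \<otimes>\<^bsub>stab\<^esub> k)) = h (commutator_part g) \<otimes> h (commutator_part k)"
    using hom_mult[OF h n] commutator_part_mult[OF g k] by simp
  moreover have "a [^] degree (g \<otimes>\<^bsub>stab\<^esub> k) = a [^] degree g \<otimes> a [^] degree k"
    using g k a by (simp add: degree_mult A.int_pow_mult)
  ultimately show "h (commutator_part (g \<otimes>\<^bsub>stab\<^esub> k)) \<otimes> a [^] degree (g \<otimes>\<^bsub>stab\<^esub> k)
      = h (commutator_part g) \<otimes> a [^] degree g \<otimes> (h (commutator_part k) \<otimes> a [^] degree k)"
    using hc[OF n(1)] hc[OF n(2)] a by (simp add: A.m_ac)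
qed

text \<open>
  Going from \<open>x0\<close> to \<open>y\<close>, then along \<open>g\<close>, and back to \<open>x0\<close>: an element of the stabilizer of \<open>x0\<close>, by
  \<open>transport_stab\<close>. Consecutive loops compose, which makes
  \<open>F (loop g y)\<close> a crossed homomorphism for every homomorphism \<open>F\<close> on the stabilizer.
\<close>

abbreviation "loop g y \<equiv> inv\<^bsub>Env\<^esub> (transport (act g y)) \<otimes>\<^bsub>Env\<^esub> g \<otimes>\<^bsub>Env\<^esub> transport y"

lemma loop_mult:
  assumes "g \<in> carrier Env" "h \<in> carrier Env" "y \<in> X"
  shows "loop (g \<otimes>\<^bsub>Env\<^esub> h) y = loop g (act h y) \<otimes>\<^bsub>Env\<^esub> loop h y"
  using assms by (simp add: env_act_mult env_act_closed transport G.m_assoc)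

text \<open>
  Both sides are the value at \<open>x0\<close> of the one-cocycle on
  \<open>g s(y) = s(g \<triangleright> y) l\<close>, where \<open>s\<close> is \<open>transport\<close> and \<open>l\<close> is the loop of \<open>g\<close> at \<open>y\<close>. Up to a
  coboundary, \<open>q\<close> is thus determined by its homomorphism on the stabilizer.
\<close>

lemma cocycle_of_loop:
  assumes q: "q \<in> Z2" and g: "g \<in> carrier Env" and y: "y \<in> X"
  shows "\<ff> q g y \<otimes> \<ff> q (transport y) x0
    = \<ff> q (transport (act g y)) x0 \<otimes> \<ff> q (loop g y) x0"
proof -
  note gy = env_act_closed[OF g y]
  note s = transport[OF y] transport[OF gy]
  have l: "loop g y \<in> carrier Env" "act (loop g y) x0 = x0"
    using transport_stab[OF g y] by simp_all
  have "\<ff> q (g \<otimes>\<^bsub>Env\<^esub> transport y) x0 = \<ff> q g y \<otimes> \<ff> q (transport y) x0"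
    using cocycle_of_mult[OF q g s(1) x0] by (simp only: s(2))
  moreover have "\<ff> q (transport (act g y) \<otimes>\<^bsub>Env\<^esub> loop g y) x0
      = \<ff> q (transport (act g y)) x0 \<otimes> \<ff> q (loop g y) x0"
    using cocycle_of_mult[OF q s(3) l(1) x0] by (simp only: l(2))
  moreover have "transport (act g y) \<otimes>\<^bsub>Env\<^esub> loop g y = g \<otimes>\<^bsub>Env\<^esub> transport y"
    using g s by (simp add: G.m_assoc)
  ultimately show ?thesis by (simp only:)
qed

definition invariants :: "('a \<times> 'a \<Rightarrow> 'b) \<Rightarrow> 'b \<times> ('a word set \<Rightarrow> 'b)" where
  "invariants q = (q (x0, x0), restrict_N0 X (\<triangleright>) x0 (\<ff> q))"

text \<open>
  The two invariants together carry the same information as the homomorphism on the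
  whole stabilizer, which is the form needed for Shapiro's lemma.
\<close>

lemma invariants_eq_iff:
  assumes q: "q \<in> Z2" "q' \<in> Z2"
  shows "invariants q = invariants q' \<longleftrightarrow> (\<forall>g\<in>carrier stab. \<ff> q g x0 = \<ff> q' g x0)"
proof
  assume inv: "invariants q = invariants q'"
  show "\<forall>g\<in>carrier stab. \<ff> q g x0 = \<ff> q' g x0"
  proof
    fix g assume g: "g \<in> carrier stab"
    have res: "restrict_N0 X (\<triangleright>) x0 (\<ff> q) = restrict_N0 X (\<triangleright>) x0 (\<ff> q')"
      using inv by (simp add: invariants_def)
    have n: "\<ff> q (commutator_part g) x0 = \<ff> q' (commutator_part g) x0"
      using fun_cong[OF res, of "commutator_part g"] commutator_part_stab[OF g] unfolding restrict_N0_def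
      by (simp only: restrict_apply')
    have "\<ff> q t x0 = \<ff> q' t x0"
      using inv x0 q by (simp add: invariants_def cocycle_of_Z1(2))
    with n show "\<ff> q g x0 = \<ff> q' g x0"
      using stab_hom_split[OF cocycle_of_stab_hom[OF q(1)] g]
        stab_hom_split[OF cocycle_of_stab_hom[OF q(2)] g] by (simp only:)
  qed
next
  assume eq: "\<forall>g\<in>carrier stab. \<ff> q g x0 = \<ff> q' g x0"
  have "q (x0, x0) = q' (x0, x0)"
    using eq[rule_format, OF t_stab] x0 q by (simp add: cocycle_of_Z1(2))
  moreover have "restrict_N0 X (\<triangleright>) x0 (\<ff> q) = restrict_N0 X (\<triangleright>) x0 (\<ff> q')"
    unfolding restrict_N0_def using eq by (intro restrict_ext) (simp add: N.mem_carrier)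
  ultimately show "invariants q = invariants q'" by (simp add: invariants_def)
qed

text \<open>
  If \<open>q\<close> changes by the coboundary of \<open>\<gamma>\<close>, the one-cocycle at \<open>g\<close> and \<open>y\<close> changes by
  \<open>\<gamma> (g \<triangleright> y) - \<gamma> y\<close>, which is 0 when \<open>y = x0\<close> is fixed by \<open>g\<close>.
\<close>

lemma equivalent_imp_invariants:
  assumes "(q, q') \<in> rack_equivalent X (\<triangleright>) A"
  shows "invariants q = invariants q'"
proof -
  obtain \<gamma> where q: "q \<in> Z2" "q' \<in> Z2" and \<gamma>: "\<gamma> \<in> X \<rightarrow> carrier A"
    and eq: "\<And>x y. \<lbrakk>x \<in> X; y \<in> X\<rbrakk> \<Longrightarrow> q' (x, y) = q (x, y) \<otimes> \<gamma> (x \<triangleright> y) \<otimes> inv (\<gamma> y)"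
    using assms by (auto simp: rack_equivalent_def)
  have \<gamma>c: "\<gamma> y \<in> carrier A" if "y \<in> X" for y using \<gamma> that by auto
  have val: "\<ff> q' g y = \<ff> q g y \<otimes> \<gamma> (act g y) \<otimes> inv (\<gamma> y)"
    if "g \<in> carrier Env" "y \<in> X" for g y
  proof (rule cocycle_of_eqI[OF q(2), where \<phi> = "\<lambda>g y. \<ff> q g y \<otimes> \<gamma> (act g y) \<otimes> inv (\<gamma> y)"])
    fix g h y assume gh: "g \<in> carrier Env" "h \<in> carrier Env" and y: "y \<in> X"
    note hy = env_act_closed[OF gh(2) y]
    note ghy = env_act_closed[OF gh(1) hy]
    note c = cocycle_of_closed[OF q(1) gh(1) hy] cocycle_of_closed[OF q(1) gh(2) y]
      \<gamma>c[OF y] \<gamma>c[OF hy] \<gamma>c[OF ghy]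
    \<comment> \<open>The two occurrences of the intermediate value of \<open>\<gamma>\<close> are brought together; they cancel.\<close>
    have cancel: "\<ff> q g (act h y) \<otimes> \<gamma> (act g (act h y)) \<otimes> inv (\<gamma> (act h y))
          \<otimes> (\<ff> q h y \<otimes> \<gamma> (act h y) \<otimes> inv (\<gamma> y))
        = (\<gamma> (act h y) \<otimes> inv (\<gamma> (act h y)))
          \<otimes> (\<ff> q g (act h y) \<otimes> \<ff> q h y \<otimes> \<gamma> (act g (act h y)) \<otimes> inv (\<gamma> y))"
      using c by (simp add: A.m_ac del: A.r_inv A.Units_r_inv A.mult_inv_cancel)
    show "\<ff> q (g \<otimes>\<^bsub>Env\<^esub> h) y \<otimes> \<gamma> (act (g \<otimes>\<^bsub>Env\<^esub> h) y) \<otimes> inv (\<gamma> y)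
        = \<ff> q g (act h y) \<otimes> \<gamma> (act g (act h y)) \<otimes> inv (\<gamma> (act h y))
          \<otimes> (\<ff> q h y \<otimes> \<gamma> (act h y) \<otimes> inv (\<gamma> y))"
      unfolding cancel cocycle_of_mult[OF q(1) gh y] env_act_mult[OF gh y]
      using c by simp
  qed (use q that \<gamma>c in \<open>simp_all add: cocycle_of_closed env_act_closed env_act_gen eq cocycle_of_Z1(2)\<close>)
  have "\<ff> q g x0 = \<ff> q' g x0" if g: "g \<in> carrier stab" for g
    using val[of g x0] g x0 q \<gamma>c[OF x0] by (simp add: A.m_assoc cocycle_of_closed)
  then show ?thesis by (simp only: invariants_eq_iff[OF q]) blast
qed

text \<open>
  In \<open>cocycle_of_loop\<close> the loop term is the same for \<open>q\<close> and \<open>q'\<close>, so subtracting the two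
  identities leaves the coboundary of the difference of the values at \<open>transport y\<close>.
\<close>

lemma invariants_imp_equivalent:
  assumes q: "q \<in> Z2" "q' \<in> Z2" and inv: "invariants q = invariants q'"
  shows "(q, q') \<in> rack_equivalent X (\<triangleright>) A"
proof -
  define b where "b q y = \<ff> q (transport y) x0" for q y
  \<comment> \<open>The cochain \<open>b q\<close> trivialises \<open>q\<close> up to its loop term, so \<open>\<gamma>\<close> is the
      difference of the cochains of \<open>q'\<close> and \<open>q\<close>.\<close>
  define \<gamma> where "\<gamma> y = inv (b q y) \<otimes> b q' y" for y
  have bc: "b r y \<in> carrier A" if "r \<in> Z2" "y \<in> X" for r y
    using that transport(1) x0 by (simp add: b_def cocycle_of_closed)
  have \<gamma>c: "\<gamma> y \<in> carrier A" if "y \<in> X" for y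
    using that q bc by (simp add: \<gamma>_def)
  have "q' (x, y) = q (x, y) \<otimes> \<gamma> (x \<triangleright> y) \<otimes> inv (\<gamma> y)" if x: "x \<in> X" and y: "y \<in> X" for x y
  proof -
    note xy = closed[OF x y]
    define c where "c = \<ff> q (loop (gen x) y) x0"
    have l: "loop (gen x) y \<in> carrier stab" by (rule transport_stab[OF gen_carrier[OF x] y])
    \<comment> \<open>Loops lie in the stabilizer, where the two one-cocycles agree.\<close>
    have c': "\<ff> q' (loop (gen x) y) x0 = c"
      using inv l unfolding invariants_eq_iff[OF q] c_def by metis
    have cc: "c \<in> carrier A" using l q x0 by (simp add: c_def cocycle_of_closed)
    have val: "r (x, y) = b r (x \<triangleright> y) \<otimes> c \<otimes> inv (b r y)"
      if r: "r \<in> Z2" "\<ff> r (loop (gen x) y) x0 = c" for r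
    proof -
      have "r (x, y) \<otimes> b r y = b r (x \<triangleright> y) \<otimes> c"
        using cocycle_of_loop[OF r(1) gen_carrier[OF x] y] r x y
        by (simp add: b_def cocycle_of_Z1(2) env_act_gen)
      then show ?thesis
        using bc[OF r(1) y] bc[OF r(1) xy] cc cocycle_closed[OF r(1) x y]
        by (metis A.inv_solve_right A.m_closed)
    qed
    note B = bc[OF q(1) y] bc[OF q(1) xy] bc[OF q(2) y] bc[OF q(2) xy] cc
    have "q (x, y) \<otimes> \<gamma> (x \<triangleright> y) \<otimes> inv (\<gamma> y)
        = (b q (x \<triangleright> y) \<otimes> inv (b q (x \<triangleright> y))) \<otimes> (b q y \<otimes> inv (b q y))
          \<otimes> (b q' (x \<triangleright> y) \<otimes> c \<otimes> inv (b q' y))"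
      unfolding val[OF q(1) c_def[symmetric]] \<gamma>_def using B
      by (simp add: A.inv_mult A.m_ac del: A.r_inv A.Units_r_inv A.mult_inv_cancel)
    also have "\<dots> = q' (x, y)"
      unfolding val[OF q(2) c'] using B by simp
    finally show ?thesis by simp
  qed
  then show ?thesis using q \<gamma>c unfolding rack_equivalent_def by blast
qed

text \<open>
  The pair \<open>(a, h)\<close> extends to a homomorphism \<open>F\<close> on the stabilizer, and the rack cocycle is
  \<open>q (x, y) = F (loop x y)\<close>. Its own homomorphism on the stabilizer is \<open>F\<close> again: the loop of \<open>g\<close> at
  \<open>x0\<close> is a conjugate of \<open>g\<close> by an element of the stabilizer, and \<open>A\<close> is commutative.
\<close>

lemma invariants_surj:
  assumes a: "a \<in> carrier A" and h: "h \<in> hom N0 A" "h \<in> extensional (carrier N0)"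
  shows "\<exists>q\<in>Z2. invariants q = (a, h)"
proof -
  define F where "F g = h (commutator_part g) \<otimes> a [^] degree g" for g
  have F: "F \<in> hom stab A" using stab_hom_extend[OF h(1) a] unfolding F_def .
  interpret F: group_hom stab A F
    by (simp add: group_hom_def group_hom_axioms_def F group_stab A.is_group)
  define \<phi> where "\<phi> g y = F (loop g y)" for g y
  have closed: "\<phi> g y \<in> carrier A" if "g \<in> carrier Env" "y \<in> X" for g y
    unfolding \<phi>_def by (rule F.hom_closed[OF transport_stab[OF that]])
  have crossed: "\<phi> (g \<otimes>\<^bsub>Env\<^esub> k) y = \<phi> g (act k y) \<otimes> \<phi> k y"
    if "g \<in> carrier Env" "k \<in> carrier Env" "y \<in> X" for g k y
    unfolding \<phi>_def loop_mult[OF that]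
    using F.hom_mult[OF transport_stab[OF that(1) env_act_closed[OF that(2,3)]]
        transport_stab[OF that(2,3)]] unfolding stab_simps(2) .
  define q where "q = (\<lambda>(x, y)\<in>X \<times> X. \<phi> (gen x) y)"
  have q: "q \<in> Z2" unfolding q_def by (rule crossed_rack_cocycle[OF closed crossed])
  have fq: "\<ff> q g y = \<phi> g y" if "g \<in> carrier Env" "y \<in> X" for g y
    by (rule cocycle_of_eqI[OF q closed crossed _ that]) (simp_all add: q_def)
  \<comment> \<open>The value \<open>transport x0\<close> need not be 1, but it fixes \<open>x0\<close>.\<close>
  have on_stab: "\<ff> q g x0 = F g" if g: "g \<in> carrier stab" for g
  proof -
    have s: "transport x0 \<in> carrier stab" using transport[OF x0] by simp
    have si: "inv\<^bsub>Env\<^esub> (transport x0) \<in> carrier stab"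
      using s act_inv_fixed by simp
    have "F (inv\<^bsub>Env\<^esub> (transport x0)) \<otimes> F (transport x0) = \<one>"
      using F.hom_mult[OF si s] F.hom_one s by simp
    moreover have "F (loop g x0)
        = F (inv\<^bsub>Env\<^esub> (transport x0)) \<otimes> F g \<otimes> F (transport x0)"
      using F.hom_mult[OF si g] F.hom_mult[OF F.G.m_closed[OF si g] s] g by simp
    ultimately have "F (loop g x0) = F g"
      using F.hom_closed[OF g] F.hom_closed[OF s] F.hom_closed[OF si]
      by (metis A.m_assoc A.m_comm A.r_one)
    then show ?thesis using fq[of g x0] g x0 by (simp add: \<phi>_def)
  qed
  have "q (x0, x0) = F t"
    using on_stab[OF t_stab] cocycle_of_Z1(2)[OF q x0 x0] by simp
  also have "\<dots> = a"
    using a hom_one[OF h(1) group_N0 A.is_group] x0 by (simp add: F_def commutator_part_t degree_gen)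
  finally have "q (x0, x0) = a" .
  moreover have "restrict_N0 X (\<triangleright>) x0 (\<ff> q) = h"
  proof (rule extensionalityI[OF _ h(2)])
    show "restrict_N0 X (\<triangleright>) x0 (\<ff> q) \<in> extensional (carrier N0)"
      by (simp add: restrict_N0_def)
    fix n assume n: "n \<in> carrier N0"
    then have nN: "n \<in> N" "n \<in> carrier stab" by (simp_all add: N.mem_carrier)
    have "h n \<in> carrier A" using h(1) n by (auto simp: hom_def)
    then have "F n = h n" using nN by (simp add: F_def commutator_part_ident degree_commutator)
    then show "restrict_N0 X (\<triangleright>) x0 (\<ff> q) n = h n"
      using n on_stab[OF nN(2)] by (simp add: restrict_N0_def)
  qed
  ultimately show ?thesis using q by (auto simp: invariants_def)
qed

subsection \<open>The isomorphism\<close>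

abbreviation "target \<equiv> A \<times>\<times> Hom_group N0 A"

lemma group_target: "group target"
  by (intro DirProd_group A.is_group group_Hom_group group_N0 A.comm_group_axioms)

lemma invariants_hom: "invariants \<in> hom (rack_Z2 X (\<triangleright>) A) target"
proof (rule homI, unfold rack_Z2_simps)
  fix q q' assume q: "q \<in> Z2"
  have "restrict_N0 X (\<triangleright>) x0 (\<ff> q) \<in> hom N0 A"
    using q x0 N0_simps group.is_monoid[OF group_N0]
    by (intro homI) (auto simp: restrict_N0_def cocycle_of_mult cocycle_of_closed N.mem_carrier
        env_act_mult)
  then show "invariants q \<in> carrier target"
    using q x0 by (simp add: invariants_def Hom_group_def cocycle_closed restrict_N0_def)
  assume q': "q' \<in> Z2"
  show "invariants (\<lambda>p\<in>X \<times> X. q p \<otimes> q' p) = invariants q \<otimes>\<^bsub>target\<^esub> invariants q'"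
    using q q' x0
    by (auto simp: invariants_def Hom_group_def restrict_N0_def cocycle_of_prod N.mem_carrier
        intro!: restrict_ext)
qed

sublocale invariants: group_hom "rack_Z2 X (\<triangleright>) A" target invariants
  by (simp add: group_hom_def group_hom_axioms_def invariants_hom group_rack_Z2 group_target)

lemma invariants_image: "invariants ` Z2 = carrier target"
proof
  show "invariants ` Z2 \<subseteq> carrier target"
    using invariants.hom_closed unfolding rack_Z2_simps by blast
  show "carrier target \<subseteq> invariants ` Z2"
  proof
    fix p assume "p \<in> carrier target"
    then obtain a h where "p = (a, h)" "a \<in> carrier A" "h \<in> hom N0 A" "h \<in> extensional (carrier N0)"
      by (auto simp: Hom_group_def)
    then show "p \<in> invariants ` Z2" using invariants_surj by (metis image_eqI)
  qed
qed

lemma class_eq_fibre: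
  assumes "q \<in> Z2"
  shows "rack_equivalent X (\<triangleright>) A `` {q} = {q' \<in> Z2. invariants q' = invariants q}"
proof -
  have "(q, q') \<in> rack_equivalent X (\<triangleright>) A \<longleftrightarrow> q' \<in> Z2 \<and> invariants q' = invariants q" for q'
  proof
    assume eq: "(q, q') \<in> rack_equivalent X (\<triangleright>) A"
    then have "q' \<in> Z2" unfolding rack_equivalent_def by blast
    with equivalent_imp_invariants[OF eq] show "q' \<in> Z2 \<and> invariants q' = invariants q" by simp
  qed (use invariants_imp_equivalent[OF assms] in simp)
  then show ?thesis by blast
qed

text \<open>
  Two rack cocycles are equivalent just when their invariants agree, so the cohomology classes are
  exactly the cosets of the kernel and the first isomorphism theorem applies.
\<close>

lemma rack_H2_eq_factor:
  "rack_H2 X (\<triangleright>) A = rack_Z2 X (\<triangleright>) A Mod kernel (rack_Z2 X (\<triangleright>) A) target invariants"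
proof -
  have coset: "kernel (rack_Z2 X (\<triangleright>) A) target invariants #>\<^bsub>rack_Z2 X (\<triangleright>) A\<^esub> q
      = rack_equivalent X (\<triangleright>) A `` {q}" if "q \<in> Z2" for q
    using invariants.kernel_coset[of q] that by (simp add: class_eq_fibre)
  have "Z2 // rack_equivalent X (\<triangleright>) A
      = rcosets\<^bsub>rack_Z2 X (\<triangleright>) A\<^esub> kernel (rack_Z2 X (\<triangleright>) A) target invariants"
    using coset by (auto simp: quotient_def RCOSETS_def)
  moreover have "rack_equivalent X (\<triangleright>) A `` {\<one>\<^bsub>rack_Z2 X (\<triangleright>) A\<^esub>}
      = kernel (rack_Z2 X (\<triangleright>) A) target invariants"
    using class_eq_fibre invariants.G.one_closed invariants.hom_one by (simp add: kernel_def)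
  ultimately show ?thesis by (simp add: rack_H2_def FactGroup_def)
qed

lemma rack_H2_iso:
  "\<exists>\<Phi>. \<Phi> \<in> iso (rack_H2 X (\<triangleright>) A) target \<and>
    (\<forall>q\<in>Z2. \<Phi> (rack_equivalent X (\<triangleright>) A `` {q}) = invariants q)"
proof (intro exI conjI ballI)
  show "(\<lambda>C. the_elem (invariants ` C)) \<in> iso (rack_H2 X (\<triangleright>) A) target"
    unfolding rack_H2_eq_factor
    by (rule invariants.FactGroup_iso_set) (simp only: rack_Z2_simps invariants_image)
  fix q assume "q \<in> Z2"
  then have "invariants ` (rack_equivalent X (\<triangleright>) A `` {q}) = {invariants q}"
    by (auto simp: class_eq_fibre)
  then show "the_elem (invariants ` (rack_equivalent X (\<triangleright>) A `` {q})) = invariants q" by simp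
qed

end

theorem theorem1p1:
  fixes X :: "'a set" and tr :: "'a \<Rightarrow> 'a \<Rightarrow> 'a" and x0 :: 'a
    and A :: "('b, 'm) monoid_scheme"
  assumes "quandle X tr"
    and "finite X"
    and "indecomposable X tr"
    and "x0 \<in> X"
    and "comm_group A"
  shows "(\<exists>\<Phi>. \<Phi> \<in> iso (rack_H2 X tr A) (A \<times>\<times> Hom_group (N0_group X tr x0) A) \<and>
            (\<forall>q \<in> rack_cocycles X tr A.
               \<Phi> (rack_equivalent X tr A `` {q})
                 = (q (x0, x0), restrict_N0 X tr x0 (cocycle_of X tr A q))))
       \<and> group (rack_H2 X tr A)
       \<and> group (A \<times>\<times> Hom_group (N0_group X tr x0) A)
       \<and> rack_H2 X tr A \<cong> A \<times>\<times> Hom_group (N0_group X tr x0) A"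
proof -
  interpret quandle X tr by fact
  interpret A: comm_group A by fact
  interpret rack_cohomology X tr x0 A
    by unfold_locales (use assms in auto)
  have "group (rack_H2 X tr A)"
    unfolding rack_H2_eq_factor by (rule normal.factorgroup_is_group[OF invariants.normal_kernel])
  with rack_H2_iso group_target show ?thesis
    unfolding invariants_def is_iso_def by blast
qed

end
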